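(* Let $J,R,Q\in\mathbb R^{n\times n}$, $B\in\mathbb R^{n\times m}$ with $J^\top=-J$, $R=R^\top\succeq0$, $Q=Q^\top\succ0$ define a minimal port-Hamiltonian system with $A=(J-R)Q$, $C=B^\top Q$ ($(A,B)$ controllable, $(A,C)$ observable), which is balanced with respect to the stabilizing solutions $\widehat{\mathcal P}_{\mathrm c},\widehat{\mathcal P}_{\mathrm f}$ of $$A^\top\widehat{\mathcal P}_{\mathrm c}+\widehat{\mathcal P}_{\mathrm c}A-\widehat{\mathcal P}_{\mathrm c}BB^\top\widehat{\mathcal P}_{\mathrm c}+C^\top C=0,\qquad A\widehat{\mathcal P}_{\mathrm f}+\widehat{\mathcal P}_{\mathrm f}A^\top-\widehat{\mathcal P}_{\mathrm f}C^\top C\widehat{\mathcal P}_{\mathrm f}+BB^\top+2R=0,$$ i.e. $\widehat{\mathcal P}_{\mathrm f}=\widehat{\mathcal P}_{\mathrm c}=\Sigma=\mathrm{diag}(\Sigma_1,\Sigma_2)$ is diagonal with $\Sigma_1=\mathrm{diag}(\sigma_1,\dots,\sigma_r)$, $\Sigma_2=\mathrm{diag}(\sigma_{r+1},\dots,\sigma_n)$. Let $(\widehat A_r,\widehat B_r,\widehat C_r)$ be the reduced-order model of order $r$ obtained from this balanced system by the effort-constraint method (see context), and let $\begin{bmatrix} M \\ N \end{bmatrix}$ and $\begin{bmatrix} \widehat M_r \\ \widehat N_r \end{bmatrix}$ be the associated right coprime factorizations of the full and the reduced system (see context). Then $$\left\|\begin{bmatrix} M \\ N \end{bmatrix}-\begin{bmatrix}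 \widehat M_r \\ \widehat N_r \end{bmatrix}\right\|_{\mathcal H_\infty}\le 2\sum_{i=r+1}^n\frac{\sigma_i}{\sqrt{1+\sigma_i^2}}.$$
   Context: Stabilizing means that $A-BB^\top\widehat{\mathcal P}_{\mathrm c}$, respectively $A-\widehat{\mathcal P}_{\mathrm f}C^\top C$, has all eigenvalues in the open left half plane. Effort-constraint reduced model (for the already balanced system): partition $J=\begin{bmatrix} J_{11} & J_{12} \\ J_{21} & J_{22} \end{bmatrix}$, $R=\begin{bmatrix} R_{11} & R_{12} \\ R_{21} & R_{22} \end{bmatrix}$, $Q=\begin{bmatrix} Q_{11} & Q_{12} \\ Q_{21} & Q_{22} \end{bmatrix}$, $B=\begin{bmatrix} B_1 \\ B_2 \end{bmatrix}$ with leading blocks of size $r$, and set $\widehat Q_r=Q_{11}-Q_{12}Q_{22}^{-1}Q_{21}$, $\widehat A_r=(J_{11}-R_{11})\widehat Q_r$, $\widehat B_r=B_1$, $\widehat C_r=B_1^\top\widehat Q_r$. (For the balanced system this coincides with truncation of $(A,B,C)$ to its leading blocks.) Right coprime factorization of the full system: with $A_{\widehat{\mathcal P}_{\mathrm c}}=A-BB^\top\widehat{\mathcal P}_{\mathrm c}$, $N(s)=C(sI_n-A_{\widehat{\mathcal P}_{\mathrm c}})^{-1}B$, $M(s)=I_m-B^\top\widehat{\mathcal P}_{\mathrm c}(sI_n-A_{\widehat{\mathcal P}_{\mathrm c}})^{-1}B$, so that $C(sI_n-A)^{-1}B=N(s)M(s)^{-1}$. For the reduced system the same formulas are used with $(\widehat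 A_r,\widehat B_r,\widehat C_r)$ and $\Sigma_1$ in place of $(A,B,C)$ and $\widehat{\mathcal P}_{\mathrm c}$ ($\Sigma_1$ solves the control Riccati equation of the reduced system): with $\widehat A_\Sigma=\widehat A_r-\widehat B_r\widehat B_r^\top\Sigma_1$, $\widehat N_r(s)=\widehat C_r(sI_r-\widehat A_\Sigma)^{-1}\widehat B_r$, $\widehat M_r(s)=I_m-\widehat B_r^\top\Sigma_1(sI_r-\widehat A_\Sigma)^{-1}\widehat B_r$. $\|F\|_{\mathcal H_\infty}=\sup_{z\in\mathbb C_+}\|F(z)\|_2$, where $\mathbb C_+$ is the open right half plane and $\|\cdot\|_2$ the spectral norm. *)

theory Defs
  imports
    "HOL-Library.Extended_Real"
    "HOL-Analysis.L2_Norm"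
    "Jordan_Normal_Form.Gauss_Jordan_Elimination"
    "Jordan_Normal_Form.Char_Poly"
begin

text \<open>Matrices have dimensions given by natural numbers; rows, columns and the diagonal entries
  \<open>\<sigma> 0, \<dots>, \<sigma> (n - 1)\<close> are indexed from 0.\<close>

abbreviation cmat :: "real mat \<Rightarrow> complex mat" where
  "cmat \<equiv> map_mat complex_of_real"

text \<open>Only meaningful for nonsingular matrices.\<close>
definition mat_inv :: "'a :: field mat \<Rightarrow> 'a mat" where
  "mat_inv X = the (mat_inverse X)"

definition sym_pos_semidef :: "real mat \<Rightarrow> bool" where
  "sym_pos_semidef X \<longleftrightarrow> square_mat X \<and> X\<^sup>T = X \<and>
     (\<forall>v \<in> carrier_vec (dim_row X). 0 \<le> v \<bullet> (X *\<^sub>v v))"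

definition sym_pos_def :: "real mat \<Rightarrow> bool" where
  "sym_pos_def X \<longleftrightarrow> square_mat X \<and> X\<^sup>T = X \<and>
     (\<forall>v \<in> carrier_vec (dim_row X). v \<noteq> 0\<^sub>v (dim_row X) \<longrightarrow> 0 < v \<bullet> (X *\<^sub>v v))"

definition stable_mat :: "real mat \<Rightarrow> bool" where
  "stable_mat X \<longleftrightarrow> (\<forall>l. eigenvalue (cmat X) l \<longrightarrow> Re l < 0)"

subsection \<open>Controllability and observability\<close>

text \<open>\<open>x\<close> solves \<open>x' = A x + f\<close> on the interval from 0 to \<open>T\<close>.\<close>
definition solves_lti :: "real mat \<Rightarrow> (real \<Rightarrow> real vec) \<Rightarrow> real \<Rightarrow> (real \<Rightarrow> real vec) \<Rightarrow> bool" where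
  "solves_lti A f T x \<longleftrightarrow> (\<forall>t \<in> {0..T}. x t \<in> carrier_vec (dim_row A) \<and>
     (\<forall>i < dim_row A.
        ((\<lambda>s. x s $ i) has_real_derivative (A *\<^sub>v x t + f t) $ i) (at t within {0..T})))"

definition controllable :: "real mat \<Rightarrow> real mat \<Rightarrow> bool" where
  "controllable A B \<longleftrightarrow>
     (\<forall>T > 0. \<forall>x0 \<in> carrier_vec (dim_row A). \<forall>x1 \<in> carrier_vec (dim_row A).
        \<exists>u x. (\<forall>t \<in> {0..T}. u t \<in> carrier_vec (dim_col B)) \<and>
              (\<forall>j < dim_col B. continuous_on {0..T} (\<lambda>t. u t $ j)) \<and>
              solves_lti A (\<lambda>t. B *\<^sub>v u t) T x \<and> x 0 = x0 \<and> x T = x1)"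

definition observable :: "real mat \<Rightarrow> real mat \<Rightarrow> bool" where
  "observable A C \<longleftrightarrow>
     (\<forall>T > 0. \<forall>x y.
        solves_lti A (\<lambda>t. 0\<^sub>v (dim_row A)) T x \<and> solves_lti A (\<lambda>t. 0\<^sub>v (dim_row A)) T y \<and>
        (\<forall>t \<in> {0..T}. C *\<^sub>v x t = C *\<^sub>v y t) \<longrightarrow> x 0 = y 0)"

subsection \<open>Stabilizing solutions of the Riccati equations\<close>

definition control_riccati_stabilizing ::
    "real mat \<Rightarrow> real mat \<Rightarrow> real mat \<Rightarrow> real mat \<Rightarrow> bool" where
  "control_riccati_stabilizing A B C P \<longleftrightarrow>
     P \<in> carrier_mat (dim_row A) (dim_row A) \<and>
     A\<^sup>T * P + P * A - P * B * B\<^sup>T * P + C\<^sup>T * C = 0\<^sub>m (dim_row A) (dim_row A) \<and>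
     stable_mat (A - B * B\<^sup>T * P)"

definition filter_riccati_stabilizing ::
    "real mat \<Rightarrow> real mat \<Rightarrow> real mat \<Rightarrow> real mat \<Rightarrow> real mat \<Rightarrow> bool" where
  "filter_riccati_stabilizing A B C R P \<longleftrightarrow>
     P \<in> carrier_mat (dim_row A) (dim_row A) \<and>
     A * P + P * A\<^sup>T - P * C\<^sup>T * C * P + B * B\<^sup>T + 2 \<cdot>\<^sub>m R = 0\<^sub>m (dim_row A) (dim_row A) \<and>
     stable_mat (A - P * C\<^sup>T * C)"

subsection \<open>Effort-constraint reduction\<close>

definition lead_block :: "nat \<Rightarrow> nat \<Rightarrow> 'a mat \<Rightarrow> 'a mat" where
  "lead_block p q X = fst (split_block X p q)"

definition ec_Q :: "nat \<Rightarrow> real mat \<Rightarrow> real mat" where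
  "ec_Q r Q = (case split_block Q r r of (Q11, Q12, Q21, Q22) \<Rightarrow> Q11 - Q12 * mat_inv Q22 * Q21)"

definition ec_A :: "nat \<Rightarrow> real mat \<Rightarrow> real mat \<Rightarrow> real mat \<Rightarrow> real mat" where
  "ec_A r J R Q = (lead_block r r J - lead_block r r R) * ec_Q r Q"

definition ec_B :: "nat \<Rightarrow> real mat \<Rightarrow> real mat" where
  "ec_B r B = lead_block r (dim_col B) B"

definition ec_C :: "nat \<Rightarrow> real mat \<Rightarrow> real mat \<Rightarrow> real mat" where
  "ec_C r Q B = (ec_B r B)\<^sup>T * ec_Q r Q"

subsection \<open>Right coprime factors\<close>

definition closed_loop :: "real mat \<Rightarrow> real mat \<Rightarrow> real mat \<Rightarrow> real mat" where
  "closed_loop A B P = A - B * B\<^sup>T * P"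

text \<open>\<open>(s I - X)\<^sup>-\<^sup>1\<close>, only meaningful if \<open>s\<close> is not an eigenvalue of \<open>X\<close>.\<close>
definition resolvent_mat :: "real mat \<Rightarrow> complex \<Rightarrow> complex mat" where
  "resolvent_mat X s = mat_inv (s \<cdot>\<^sub>m 1\<^sub>m (dim_row X) - cmat X)"

definition rcf_N :: "real mat \<Rightarrow> real mat \<Rightarrow> real mat \<Rightarrow> real mat \<Rightarrow> complex \<Rightarrow> complex mat" where
  "rcf_N A B C P s = cmat C * resolvent_mat (closed_loop A B P) s * cmat B"

definition rcf_M :: "real mat \<Rightarrow> real mat \<Rightarrow> real mat \<Rightarrow> complex \<Rightarrow> complex mat" where
  "rcf_M A B P s = 1\<^sub>m (dim_col B) - cmat (B\<^sup>T * P) * resolvent_mat (closed_loop A B P) s * cmat B"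

definition rcf :: "real mat \<Rightarrow> real mat \<Rightarrow> real mat \<Rightarrow> real mat \<Rightarrow> complex \<Rightarrow> complex mat" where
  "rcf A B C P s = rcf_M A B P s @\<^sub>r rcf_N A B C P s"

subsection \<open>The norm of the Hardy space\<close>

definition vec_norm2 :: "complex vec \<Rightarrow> real" where
  "vec_norm2 v = L2_set (\<lambda>i. cmod (v $ i)) {..<dim_vec v}"

definition spectral_norm :: "complex mat \<Rightarrow> real" where
  "spectral_norm X =
     (SUP v \<in> {v \<in> carrier_vec (dim_col X). vec_norm2 v \<le> 1}. vec_norm2 (X *\<^sub>v v))"

text \<open>Extended-real valued: an unbounded function has norm \<open>\<infinity>\<close>.\<close>
definition hinf_norm :: "(complex \<Rightarrow> complex mat) \<Rightarrow> ereal" where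
  "hinf_norm F = (SUP z \<in> {z. 0 < Re z}. ereal (spectral_norm (F z)))"

end

theory Submission
  imports Defs "Jordan_Normal_Form.Schur_Decomposition"
begin

text \<open>
  The matrix \<open>Q\<^sup>-\<^sup>1\<close> solves the filter Riccati equation, and comparing it with the stabilizing
  solution by a Sylvester argument gives \<open>\<Sigma> = Q\<^sup>-\<^sup>1\<close>. Hence \<open>Q\<close> is diagonal and the coprime
  factorization of the reduced model is the truncation of that of the full model, whose state
  matrix is \<open>F = A - B B\<^sup>T \<Sigma>\<close> and whose output matrix is \<open>H = [-B\<^sup>T \<Sigma>; C]\<close>.
  With \<open>S = Q + \<Sigma>\<close> the control Riccati equation yields
  \<open>F\<^sup>T \<Sigma> + \<Sigma> F + H\<^sup>T H = 0\<close> and \<open>S F + F\<^sup>T S + S B B\<^sup>T S = - 2 Q R Q \<le> 0\<close>, so \<open>\<Sigma>\<close> and \<open>S\<^sup>-\<^sup>1\<close>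
  are diagonal generalized Gramians with \<open>\<sigma>\<^sub>i / S\<^sub>i = \<sigma>\<^sub>i\<^sup>2 / (1 + \<sigma>\<^sub>i\<^sup>2)\<close>. Removing the states one at
  a time, each step costs at most \<open>2 sqrt (\<sigma>\<^sub>i / S\<^sub>i)\<close>, pointwise at each \<open>z\<close> with
  \<open>Re z > 0\<close>; no stability of the truncated systems is needed.\<close>

subsection \<open>Weighted inner products\<close>

text \<open>Taking the real part makes the form symmetric and real bilinear, which is all that
  energy balances need. The weight is a function, so the diagonal Gramians enter by their
  entries.\<close>

definition wip :: "(nat \<Rightarrow> real) \<Rightarrow> complex vec \<Rightarrow> complex vec \<Rightarrow> real" where
  "wip X v w = (\<Sum>i<dim_vec w. X i * Re (v $ i * cnj (w $ i)))"

abbreviation rip :: "complex vec \<Rightarrow> complex vec \<Rightarrow> real" where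
  "rip \<equiv> wip (\<lambda>_. 1)"

lemma wip_commute: "dim_vec v = dim_vec w \<Longrightarrow> wip X v w = wip X w v"
  unfolding wip_def by (intro sum.cong) (auto simp: mult.commute)

lemma wip_add_left:
  assumes "v \<in> carrier_vec n" "v' \<in> carrier_vec n" "w \<in> carrier_vec n"
  shows "wip X (v + v') w = wip X v w + wip X v' w"
  using assms unfolding wip_def sum.distrib[symmetric] by (intro sum.cong) (auto simp: algebra_simps)

lemma wip_diff_left:
  assumes "v \<in> carrier_vec n" "v' \<in> carrier_vec n" "w \<in> carrier_vec n"
  shows "wip X (v - v') w = wip X v w - wip X v' w"
  using assms unfolding wip_def sum_subtractf[symmetric] by (intro sum.cong) (auto simp: algebra_simps)

lemma wip_uminus_left:
  assumes "v \<in> carrier_vec n" "w \<in> carrier_vec n"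
  shows "wip X (- v) w = - wip X v w"
  using assms unfolding wip_def sum_negf[symmetric] by (intro sum.cong) (auto simp: algebra_simps)

lemma wip_smult_left:
  assumes "v \<in> carrier_vec n" "w \<in> carrier_vec n"
  shows "wip X (complex_of_real c \<cdot>\<^sub>v v) w = c * wip X v w"
  using assms unfolding wip_def sum_distrib_left by (intro sum.cong) (auto simp: algebra_simps)

lemma wip_add_right:
  assumes "v \<in> carrier_vec n" "w \<in> carrier_vec n" "w' \<in> carrier_vec n"
  shows "wip X v (w + w') = wip X v w + wip X v w'"
  using assms wip_add_left[OF assms(2,3,1), of X] wip_commute[of v "w + w'" X]
    wip_commute[of v w X] wip_commute[of v w' X] by simp

lemma wip_diff_right:
  assumes "v \<in> carrier_vec n" "w \<in> carrier_vec n" "w' \<in> carrier_vec n"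
  shows "wip X v (w - w') = wip X v w - wip X v w'"
  using assms wip_diff_left[OF assms(2,3,1), of X] wip_commute[of v "w - w'" X]
    wip_commute[of v w X] wip_commute[of v w' X] by simp

lemma wip_self: "wip X v v = (\<Sum>i<dim_vec v. X i * (cmod (v $ i))\<^sup>2)"
  unfolding wip_def by (simp only: complex_mult_cnj cmod_power2 Re_complex_of_real)

lemma wip_self_nonneg: "(\<And>i. i < dim_vec v \<Longrightarrow> 0 \<le> X i) \<Longrightarrow> 0 \<le> wip X v v"
  unfolding wip_self by (intro sum_nonneg) simp

lemma wip_self_eq_0D:
  assumes "\<And>i. i < n \<Longrightarrow> 0 < X i" "v \<in> carrier_vec n" "wip X v v \<le> 0"
  shows "v = 0\<^sub>v n"
proof -
  have "(\<Sum>i<dim_vec v. X i * (cmod (v $ i))\<^sup>2) = 0"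
    using assms wip_self_nonneg[of v X] unfolding wip_self by (force intro: antisym)
  then have zero: "\<forall>i\<in>{..<n}. X i * (cmod (v $ i))\<^sup>2 = 0"
    using assms(1,2) by (subst (asm) sum_nonneg_eq_0_iff) (auto simp: less_imp_le)
  show ?thesis
  proof (rule eq_vecI)
    fix i assume i: "i < dim_vec (0\<^sub>v n :: complex vec)"
    with zero have "X i * (cmod (v $ i))\<^sup>2 = 0" by simp
    with assms(1)[of i] i show "v $ i = 0\<^sub>v n $ i" by simp
  qed (use assms in simp)
qed

section \<open>Euclidean norm, adjoints and diagonal forms\<close>

lemma vec_norm2_nonneg [simp]: "0 \<le> vec_norm2 v"
  unfolding vec_norm2_def by (rule L2_set_nonneg)

lemma vec_norm2_power2: "(vec_norm2 v)\<^sup>2 = rip v v"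
  unfolding vec_norm2_def wip_self L2_set_def by (simp add: sum_nonneg)

lemma vec_norm2_zero [simp]: "vec_norm2 (0\<^sub>v n) = 0"
  unfolding vec_norm2_def L2_set_def by simp

lemma vec_norm2_add:
  assumes "v \<in> carrier_vec n" "w \<in> carrier_vec n"
  shows "vec_norm2 (v + w) \<le> vec_norm2 v + vec_norm2 w"
proof -
  have "vec_norm2 (v + w) \<le> L2_set (\<lambda>i. cmod (v $ i) + cmod (w $ i)) {..<n}"
    using assms unfolding vec_norm2_def by (auto intro!: L2_set_mono norm_triangle_ineq)
  also have "\<dots> \<le> vec_norm2 v + vec_norm2 w"
    using assms L2_set_triangle_ineq unfolding vec_norm2_def by auto
  finally show ?thesis .
qed

lemma rip_append:
  assumes "dim_vec v = dim_vec v'" "dim_vec w = dim_vec w'"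
  shows "rip (v @\<^sub>v w) (v' @\<^sub>v w') = rip v v' + rip w w'"
proof -
  have split: "(\<Sum>i<a + b. f i) = (\<Sum>i<a. f i) + (\<Sum>i<b. f (a + i))" for a b :: nat and f :: "nat \<Rightarrow> real"
    by (induction b) (simp_all add: add.assoc)
  show ?thesis
    using assms unfolding wip_def index_append_vec(2) split
    by (intro arg_cong2[where f = "(+)"] sum.cong) (simp_all del: times_complex.sel)
qed

text \<open>Real entries come out of the real part, so both sides are one double sum over the
  entries of \<open>A\<close>, summed in the two possible orders.\<close>

lemma rip_adjoint:
  assumes "A \<in> carrier_mat nr nc" "v \<in> carrier_vec nc" "w \<in> carrier_vec nr"
  shows "rip (cmat A *\<^sub>v v) w = rip v (cmat A\<^sup>T *\<^sub>v w)"
proof -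
  have re0: "Re (complex_of_real a * w) = a * Re w" for a w by simp
  have re: "Re ((\<Sum>j\<in>I. complex_of_real (a j) * f j) * c) = (\<Sum>j\<in>I. a j * Re (f j * c))"
    for a f c and I :: "nat set"
    by (simp add: sum_distrib_right mult.assoc re0 del: times_complex.sel)
  have "rip (cmat A *\<^sub>v v) w = (\<Sum>i<nr. \<Sum>j<nc. A $$ (i,j) * Re (v $ j * cnj (w $ i)))"
    using assms unfolding wip_def
    by (intro sum.cong) (simp_all add: scalar_prod_def atLeast0LessThan re del: times_complex.sel)
  also have "\<dots> = (\<Sum>j<nc. \<Sum>i<nr. A $$ (i,j) * Re (w $ i * cnj (v $ j)))"
    by (subst sum.swap) (simp add: mult.commute)
  also have "\<dots> = rip (cmat A\<^sup>T *\<^sub>v w) v"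
    using assms unfolding wip_def
    by (intro sum.cong) (simp_all add: scalar_prod_def atLeast0LessThan re del: times_complex.sel)
  also have "\<dots> = rip v (cmat A\<^sup>T *\<^sub>v w)"
    using assms by (intro wip_commute) auto
  finally show ?thesis .
qed

text \<open>Bridge between the matrices \<open>mat_diag n X\<close> of the Riccati equations and the
  weights of \<open>wip\<close>.\<close>

lemma rip_diag:
  assumes "v \<in> carrier_vec n" "w \<in> carrier_vec n"
  shows "rip v (cmat (mat_diag n X) *\<^sub>v w) = wip X v w"
proof -
  have "(cmat (mat_diag n X) *\<^sub>v w) $ i = X i * w $ i" if "i < n" for i
    using that assms unfolding mat_diag_def
    by (simp add: scalar_prod_def if_distrib[of complex_of_real] if_distrib[of "\<lambda>x. x * _"] cong: if_cong)
  then show ?thesis using assms unfolding wip_def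
    by (auto simp: algebra_simps mat_diag_def simp del: index_mult_mat_vec intro!: sum.cong)
qed

section \<open>Action of complexified real matrices on vectors\<close>

lemma cmat_add: "A \<in> carrier_mat nr nc \<Longrightarrow> B \<in> carrier_mat nr nc \<Longrightarrow> cmat (A + B) = cmat A + cmat B"
  by (rule eq_matI) auto

lemma cmat_minus: "A \<in> carrier_mat nr nc \<Longrightarrow> B \<in> carrier_mat nr nc \<Longrightarrow> cmat (A - B) = cmat A - cmat B"
  by (rule eq_matI) auto

lemma cmat_mult_vec:
  assumes "A \<in> carrier_mat nr n" "B \<in> carrier_mat n nc" "v \<in> carrier_vec nc"
  shows "cmat (A * B) *\<^sub>v v = cmat A *\<^sub>v (cmat B *\<^sub>v v)"
  using assms by (simp add: of_real_hom.mat_hom_mult[OF assms(1,2)])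

lemma cmat_add_vec:
  assumes "A \<in> carrier_mat nr nc" "B \<in> carrier_mat nr nc" "v \<in> carrier_vec nc"
  shows "cmat (A + B) *\<^sub>v v = cmat A *\<^sub>v v + cmat B *\<^sub>v v"
  using assms by (simp add: cmat_add add_mult_distrib_mat_vec[of _ nr nc])

lemma cmat_minus_vec:
  assumes "A \<in> carrier_mat nr nc" "B \<in> carrier_mat nr nc" "v \<in> carrier_vec nc"
  shows "cmat (A - B) *\<^sub>v v = cmat A *\<^sub>v v - cmat B *\<^sub>v v"
  using assms by (simp add: cmat_minus minus_mult_distrib_mat_vec[of _ nr nc])

subsection \<open>Balanced truncation\<close>

text \<open>The state at frequency \<open>z\<close> of the system truncated to its first \<open>k\<close> coordinates, padded with
  zeros to full length, so that truncations of different orders can be compared.\<close>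

definition trunc_response :: "complex mat \<Rightarrow> complex vec \<Rightarrow> complex \<Rightarrow> nat \<Rightarrow> complex vec \<Rightarrow> bool" where
  "trunc_response A b z k x \<longleftrightarrow> x \<in> carrier_vec (dim_row A) \<and>
     (\<forall>i < dim_row A. if i < k then z * x $ i = (A *\<^sub>v x + b) $ i else x $ i = 0)"

text \<open>The input cancels in \<open>d = x - y\<close>: either \<open>z * d $ i\<close> equals
  the \<open>i\<close>-th entry of \<open>A *\<^sub>v d\<close>, or \<open>d $ i\<close> is 0. Hence
  \<open>wip X (A *\<^sub>v d) d\<close> equals \<open>Re z * wip X d d\<close>, and
  \<open>L1\<close> forces \<open>d\<close> to vanish. One Lyapunov inequality for the full matrix
  serves all truncation orders.\<close>

lemma trunc_response_diff_eq_0: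
  assumes A: "A \<in> carrier_mat n n" and b: "b \<in> carrier_vec n"
    and z: "0 < Re z" and X: "\<And>i. i < n \<Longrightarrow> 0 < X i"
    and L1: "\<And>d. d \<in> carrier_vec n \<Longrightarrow> wip X (A *\<^sub>v d) d \<le> 0"
    and x: "trunc_response A b z k x" and y: "trunc_response A b z k y"
  shows "x - y = 0\<^sub>v n"
proof -
  define d where "d = x - y"
  have carr: "x \<in> carrier_vec n" "y \<in> carrier_vec n" "d \<in> carrier_vec n"
    using x y A unfolding trunc_response_def d_def by auto
  have Ad: "A *\<^sub>v d = A *\<^sub>v x - A *\<^sub>v y"
    unfolding d_def using A carr by (simp add: mult_minus_distrib_mat_vec[of _ n n])
  have "X i * Re ((A *\<^sub>v d) $ i * cnj (d $ i)) = Re z * (X i * Re (d $ i * cnj (d $ i)))"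
    if i: "i < n" for i
  proof (cases "i < k")
    case True
    then have "z * x $ i = (A *\<^sub>v x + b) $ i" "z * y $ i = (A *\<^sub>v y + b) $ i"
      using x y A i unfolding trunc_response_def by auto
    then have "(A *\<^sub>v d) $ i = z * d $ i"
      unfolding Ad using i A b carr by (simp add: d_def algebra_simps del: index_mult_mat_vec)
    then show ?thesis
      by (simp add: algebra_simps)
  next
    case False
    then have "d $ i = 0"
      using x y A i carr unfolding trunc_response_def d_def by auto
    then show ?thesis by simp
  qed
  then have "wip X (A *\<^sub>v d) d = Re z * wip X d d"
    using carr unfolding wip_def sum_distrib_left by (intro sum.cong) auto
  with L1[OF carr(3)] z have "wip X d d \<le> 0" by (simp add: mult_le_0_iff)
  then show ?thesis
    using wip_self_eq_0D[of n X d] X carr(3) unfolding d_def by blast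
qed

text \<open>With \<open>d = x - y\<close> and \<open>p = x + y\<close>, the residual \<open>w\<close> of the smaller model in its missing
  state equation enters the storage functions of \<open>d\<close> and \<open>p\<close> with opposite signs; since
  \<open>d\<close> and \<open>p\<close> agree in coordinate \<open>k\<close>, the combination weighted by \<open>t\<close> cancels it.\<close>

lemma truncate_one_state:
  assumes A: "A \<in> carrier_mat n n" and b: "b \<in> carrier_vec n"
    and z: "0 < Re z" and k: "k < n"
    and X: "\<And>i. i < n \<Longrightarrow> 0 \<le> X i" and S: "\<And>i. i < n \<Longrightarrow> 0 \<le> S i"
    and t: "0 \<le> t" "X k = t * S k"
    and x: "trunc_response A b z (Suc k) x" and y: "trunc_response A b z k y"
    and L1: "2 * wip X (A *\<^sub>v (x - y)) (x - y) + e \<le> 0"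
    and L2: "2 * wip S (A *\<^sub>v (x + y) + 2 \<cdot>\<^sub>v b) (x + y) \<le> u"
  shows "e \<le> t * u"
proof -
  define d p w where "d = x - y" and "p = x + y" and "w = (A *\<^sub>v y + b) $ k"
  have carr: "x \<in> carrier_vec n" "y \<in> carrier_vec n" "d \<in> carrier_vec n" "p \<in> carrier_vec n"
    using x y A unfolding trunc_response_def d_def p_def by auto
  have Ad: "A *\<^sub>v d = A *\<^sub>v x - A *\<^sub>v y" and Ap: "A *\<^sub>v p = A *\<^sub>v x + A *\<^sub>v y"
    unfolding d_def p_def using A carr
    by (simp_all add: mult_minus_distrib_mat_vec[of _ n n] mult_add_distrib_mat_vec[of _ n n])
  have yk: "y $ k = 0" using y k A unfolding trunc_response_def by auto
  \<comment> \<open>Below \<open>k\<close> both models satisfy their state equation. At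
    \<open>k\<close> only \<open>x\<close> does, and since \<open>y $ k = 0\<close> the residual
    \<open>w\<close> of \<open>y\<close> appears with opposite signs. Above \<open>k\<close> both
    states vanish.\<close>
  have comp: "(A *\<^sub>v d) $ i = z * d $ i - (if i = k then w else 0) \<and>
      (A *\<^sub>v p + 2 \<cdot>\<^sub>v b) $ i = z * p $ i + (if i = k then w else 0) \<or> d $ i = 0 \<and> p $ i = 0 \<and> i \<noteq> k"
    if i: "i < n" for i
  proof -
    consider "i < k" | "i = k" | "k < i" by linarith
    then show ?thesis
    proof cases
      case 1
      then have "z * x $ i = (A *\<^sub>v x + b) $ i" "z * y $ i = (A *\<^sub>v y + b) $ i"
        using x y A i unfolding trunc_response_def by auto
      then show ?thesis
        unfolding Ad Ap using i A b carr 1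
        by (simp add: d_def p_def algebra_simps del: index_mult_mat_vec)
    next
      case 2
      then have "z * x $ k = (A *\<^sub>v x + b) $ k"
        using x A i unfolding trunc_response_def by auto
      then show ?thesis
        unfolding Ad Ap using i A b carr 2 yk
        by (simp add: d_def p_def w_def algebra_simps del: index_mult_mat_vec)
    next
      case 3
      then show ?thesis
        using x y A i carr unfolding trunc_response_def d_def p_def by auto
    qed
  qed
  have split: "(\<Sum>i<n. Re z * f i + (if i = k then g else 0)) = Re z * (\<Sum>i<n. f i) + g"
    for f :: "nat \<Rightarrow> real" and g
    using k by (simp add: sum.distrib sum_distrib_left)
  define c where "c = Re (w * cnj (x $ k))"
  have dk: "d $ k = x $ k" "p $ k = x $ k"
    using yk k carr by (auto simp: d_def p_def)
  have "wip X (A *\<^sub>v d) d = (\<Sum>i<n. Re z * (X i * Re (d $ i * cnj (d $ i))) + (if i = k then - (X k * c) else 0))"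
    unfolding wip_def using carr
  proof (intro sum.cong)
    fix i assume "i \<in> {..<n}"
    then consider "(A *\<^sub>v d) $ i = z * d $ i - (if i = k then w else 0)" | "d $ i = 0" "i \<noteq> k"
      using comp[of i] by auto
    then show "X i * Re ((A *\<^sub>v d) $ i * cnj (d $ i)) =
      Re z * (X i * Re (d $ i * cnj (d $ i))) + (if i = k then - (X k * c) else 0)"
      by cases (auto simp: dk c_def ring_distribs mult_ac simp del: index_mult_mat_vec)
  qed auto
  then have 1: "wip X (A *\<^sub>v d) d = Re z * wip X d d - X k * c"
    unfolding split using carr by (simp add: wip_def)
  have "wip S (A *\<^sub>v p + 2 \<cdot>\<^sub>v b) p = (\<Sum>i<n. Re z * (S i * Re (p $ i * cnj (p $ i))) + (if i = k then S k * c else 0))"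
    unfolding wip_def using carr
  proof (intro sum.cong)
    fix i assume "i \<in> {..<n}"
    then consider "(A *\<^sub>v p + 2 \<cdot>\<^sub>v b) $ i = z * p $ i + (if i = k then w else 0)" | "p $ i = 0" "i \<noteq> k"
      using comp[of i] by auto
    then show "S i * Re ((A *\<^sub>v p + 2 \<cdot>\<^sub>v b) $ i * cnj (p $ i)) =
      Re z * (S i * Re (p $ i * cnj (p $ i))) + (if i = k then S k * c else 0)"
      by cases (auto simp: dk c_def ring_distribs mult_ac simp del: index_mult_mat_vec index_add_vec)
  qed auto
  then have 2: "wip S (A *\<^sub>v p + 2 \<cdot>\<^sub>v b) p = Re z * wip S p p + S k * c"
    unfolding split using carr by (simp add: wip_def)
  \<comment> \<open>Dropping the nonnegative stored energies leaves only the terms in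
    \<open>c\<close>. Scaling the second bound by \<open>t\<close> then eliminates \<open>c\<close>,
    because \<open>X k = t * S k\<close>.\<close>
  have "0 \<le> Re z * wip X d d" "0 \<le> Re z * wip S p p"
    using z X S carr by (auto intro!: mult_nonneg_nonneg wip_self_nonneg)
  then have "e \<le> 2 * (X k * c)" "2 * (S k * c) \<le> u"
    using L1 L2 1 2 unfolding d_def[symmetric] p_def[symmetric] by linarith+
  with mult_left_mono[OF this(2) t(1)] show ?thesis
    unfolding t(2) by (simp add: algebra_simps)
qed

section \<open>Leading blocks and solvability of the truncated state equation\<close>

lemma mat_inv_right:
  assumes "M \<in> carrier_mat n n" "det M \<noteq> 0"
  shows "mat_inv M \<in> carrier_mat n n" "M * mat_inv M = 1\<^sub>m n"
proof -
  have "M \<in> Units (ring_mat TYPE('a) n ())"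
    using det_non_zero_imp_unit[OF assms] .
  then obtain N where "mat_inverse M = Some N"
    using mat_inverse(1)[OF assms(1), where b = "()"] by (cases "mat_inverse M") auto
  with mat_inverse(2)[OF assms(1) this]
  show "mat_inv M \<in> carrier_mat n n" "M * mat_inv M = 1\<^sub>m n"
    unfolding mat_inv_def by auto
qed

lemma lead_block_carrier [simp]: "lead_block p q M \<in> carrier_mat p q"
  unfolding lead_block_def split_block_def Let_def by simp

lemma lead_block_index [simp]: "i < p \<Longrightarrow> j < q \<Longrightarrow> lead_block p q M $$ (i, j) = M $$ (i, j)"
  unfolding lead_block_def split_block_def Let_def by simp

lemma lead_block_dim [simp]: "dim_row (lead_block p q M) = p" "dim_col (lead_block p q M) = q"
  using lead_block_carrier[of p q M] by (auto simp del: lead_block_carrier)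

text \<open>The columns outside the block only meet the padding zeros.\<close>

lemma lead_block_mult_vec:
  assumes M: "M \<in> carrier_mat nr n" and y: "y \<in> carrier_vec k" and "k \<le> n" "p \<le> nr" "i < p"
  shows "(lead_block p k M *\<^sub>v y) $ i = (M *\<^sub>v (y @\<^sub>v 0\<^sub>v (n - k))) $ i"
proof -
  have "(\<Sum>j<n. M $$ (i,j) * (y @\<^sub>v 0\<^sub>v (n - k)) $ j) = (\<Sum>j<k. M $$ (i,j) * y $ j)"
    using assms by (intro sum.mono_neutral_cong_right) auto
  then show ?thesis
    using assms by (simp add: scalar_prod_def atLeast0LessThan)
qed

lemma trunc_response_append_zero:
  assumes A: "A \<in> carrier_mat n n" and b: "b \<in> carrier_vec n" and y: "y \<in> carrier_vec k" and k: "k \<le> n"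
    and eq: "(z \<cdot>\<^sub>m 1\<^sub>m k - lead_block k k A) *\<^sub>v y = vec_first b k"
  shows "trunc_response A b z k (y @\<^sub>v 0\<^sub>v (n - k))"
  unfolding trunc_response_def
proof (intro conjI allI impI)
  show "y @\<^sub>v 0\<^sub>v (n - k) \<in> carrier_vec (dim_row A)"
    using A y k by (metis append_carrier_vec carrier_matD(1) le_add_diff_inverse zero_carrier_vec)
  fix i assume i: "i < dim_row A"
  show "if i < k then z * (y @\<^sub>v 0\<^sub>v (n - k)) $ i = (A *\<^sub>v (y @\<^sub>v 0\<^sub>v (n - k)) + b) $ i
        else (y @\<^sub>v 0\<^sub>v (n - k)) $ i = 0"
  proof (cases "i < k")
    case True
    have sm: "(z \<cdot>\<^sub>m 1\<^sub>m k) *\<^sub>v y = z \<cdot>\<^sub>v y" using y by (intro eq_vecI) auto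
    have "((z \<cdot>\<^sub>m 1\<^sub>m k - lead_block k k A) *\<^sub>v y) $ i = z * y $ i - (lead_block k k A *\<^sub>v y) $ i"
      using y True by (subst minus_mult_distrib_mat_vec[of _ k k]) (auto simp: sm simp del: index_mult_mat_vec)
    then have "z * y $ i = (lead_block k k A *\<^sub>v y) $ i + b $ i"
      using True by (simp add: eq vec_first_def del: index_mult_mat_vec)
    then show ?thesis
      using True y A b i k by (simp add: lead_block_mult_vec[OF A y k k] del: index_mult_mat_vec)
  next
    case False
    then show ?thesis using A y i by auto
  qed
qed

text \<open>A kernel vector padded with zeros and the zero vector are both responses to the input 0,
  so uniqueness of responses makes the kernel trivial.\<close>

lemma det_resolvent_nonzero:
  assumes A: "A \<in> carrier_mat n n" and k: "k \<le> n"
    and z: "0 < Re z" and X: "\<And>i. i < n \<Longrightarrow> 0 < X i"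
    and L1: "\<And>d. d \<in> carrier_vec n \<Longrightarrow> wip X (A *\<^sub>v d) d \<le> 0"
  shows "det (z \<cdot>\<^sub>m 1\<^sub>m k - lead_block k k A) \<noteq> 0" (is "det ?M \<noteq> 0")
proof
  have M: "?M \<in> carrier_mat k k" by (intro minus_carrier_mat lead_block_carrier)
  assume "det ?M = 0"
  then obtain v where v: "v \<in> carrier_vec k" "v \<noteq> 0\<^sub>v k" "?M *\<^sub>v v = 0\<^sub>v k"
    unfolding det_0_iff_vec_prod_zero_field[OF M] by blast
  have 0: "vec_first (0\<^sub>v n :: complex vec) k = 0\<^sub>v k"
    using k by (auto simp: vec_first_def)
  have "?M *\<^sub>v 0\<^sub>v k = 0\<^sub>v k" using M by (intro eq_vecI) auto
  then have "(v @\<^sub>v 0\<^sub>v (n - k)) - (0\<^sub>v k @\<^sub>v 0\<^sub>v (n - k)) = 0\<^sub>v n"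
    using trunc_response_append_zero[OF A zero_carrier_vec _ k, of _ z] v
    by (intro trunc_response_diff_eq_0[OF A zero_carrier_vec z X L1, where k = k]) (simp_all add: 0)
  then have diff: "((v @\<^sub>v 0\<^sub>v (n - k)) - (0\<^sub>v k @\<^sub>v 0\<^sub>v (n - k))) $ i = 0\<^sub>v n $ i" for i
    by (rule arg_cong)
  have "v $ i = 0" if "i < k" for i
    using that v(1) k diff[of i] by simp
  with v show False by auto
qed

text \<open>Supplies the states of the intermediate models when states are removed one at a
  time.\<close>

lemma trunc_response_exists:
  assumes A: "A \<in> carrier_mat n n" and b: "b \<in> carrier_vec n" and k: "k \<le> n"
    and z: "0 < Re z" and X: "\<And>i. i < n \<Longrightarrow> 0 < X i"
    and L1: "\<And>d. d \<in> carrier_vec n \<Longrightarrow> wip X (A *\<^sub>v d) d \<le> 0"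
  shows "\<exists>x. trunc_response A b z k x"
proof -
  let ?M = "z \<cdot>\<^sub>m 1\<^sub>m k - lead_block k k A"
  have M: "?M \<in> carrier_mat k k" by (intro minus_carrier_mat lead_block_carrier)
  have "det ?M \<noteq> 0" using det_resolvent_nonzero[OF A k z] X L1 by blast
  note inv = mat_inv_right[OF M this]
  have bk: "vec_first b k \<in> carrier_vec k" by simp
  have "?M *\<^sub>v (mat_inv ?M *\<^sub>v vec_first b k) = vec_first b k"
    using inv M bk by (simp flip: assoc_mult_mat_vec[OF M inv(1) bk])
  with trunc_response_append_zero[OF A b _ k this] show ?thesis
    using mult_mat_vec_carrier[OF inv(1) bk] by blast
qed

text \<open>Induction on the larger order \<open>k\<close>, telescoping \<open>x - y\<close> through
  the responses of all intermediate orders. \<open>L1\<close> and \<open>L2\<close> are the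
  observability and controllability inequalities; \<open>u\<close> stands for the norm of the
  input.\<close>

lemma balanced_truncation_bound:
  assumes A: "A \<in> carrier_mat n n" and b: "b \<in> carrier_vec n" and H: "H \<in> carrier_mat q n"
    and z: "0 < Re z" and X: "\<And>i. i < n \<Longrightarrow> 0 < X i" and S: "\<And>i. i < n \<Longrightarrow> 0 < S i"
    and L1: "\<And>d. d \<in> carrier_vec n \<Longrightarrow> 2 * wip X (A *\<^sub>v d) d + (vec_norm2 (H *\<^sub>v d))\<^sup>2 \<le> 0"
    and L2: "\<And>p. p \<in> carrier_vec n \<Longrightarrow> 2 * wip S (A *\<^sub>v p + 2 \<cdot>\<^sub>v b) p \<le> 4 * u\<^sup>2"
    and u: "0 \<le> u"
    and y: "trunc_response A b z r y" and "r \<le> k" "k \<le> n" and "trunc_response A b z k x"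
  shows "vec_norm2 (H *\<^sub>v (x - y)) \<le> 2 * (\<Sum>i=r..<k. sqrt (X i / S i)) * u"
  using \<open>r \<le> k\<close> \<open>k \<le> n\<close> \<open>trunc_response A b z k x\<close>
proof (induction k arbitrary: x rule: dec_induct)
  have L1': "wip X (A *\<^sub>v d) d \<le> 0" if "d \<in> carrier_vec n" for d
    using L1[OF that] zero_le_power2[of "vec_norm2 (H *\<^sub>v d)"] by linarith
  {
    case base
    then have "x - y = 0\<^sub>v n"
      using trunc_response_diff_eq_0[OF A b z X L1'] y by blast
    moreover have "H *\<^sub>v 0\<^sub>v n = 0\<^sub>v q" using H by (intro eq_vecI) auto
    ultimately show ?case by simp
  next
    case (step k)
    obtain x' where x': "trunc_response A b z k x'"
      using trunc_response_exists[OF A b _ z X L1', of k] step.prems(1) by auto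
    have carr: "x \<in> carrier_vec n" "x' \<in> carrier_vec n" "y \<in> carrier_vec n"
      using A step.prems(2) x' y unfolding trunc_response_def by auto
    have k: "k < n" using step.prems(1) by simp
    \<comment> \<open>Here \<open>t\<close> is \<open>X k / S k\<close>, the ratio that balances the
      two storage functions in coordinate \<open>k\<close>. Its square root becomes the summand of
      this step.\<close>
    have "(vec_norm2 (H *\<^sub>v (x - x')))\<^sup>2 \<le> (X k / S k) * (4 * u\<^sup>2)"
    proof (rule truncate_one_state[OF A b z k _ _ _ _ step.prems(2) x'])
      show "2 * wip X (A *\<^sub>v (x - x')) (x - x') + (vec_norm2 (H *\<^sub>v (x - x')))\<^sup>2 \<le> 0"
        using carr by (intro L1) auto
      show "2 * wip S (A *\<^sub>v (x + x') + 2 \<cdot>\<^sub>v b) (x + x') \<le> 4 * u\<^sup>2"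
        using carr by (intro L2) auto
    qed (use X S k in \<open>auto intro: less_imp_le simp: less_imp_neq[THEN not_sym]\<close>)
    also have "\<dots> = (2 * sqrt (X k / S k) * u)\<^sup>2"
      using X[OF k] S[OF k] by (simp add: power_mult_distrib)
    finally have 1: "vec_norm2 (H *\<^sub>v (x - x')) \<le> 2 * sqrt (X k / S k) * u"
      by (rule power2_le_imp_le) (use u X[OF k] S[OF k] in simp)
    have "x - y = (x - x') + (x' - y)" using carr by (intro eq_vecI) auto
    then have "H *\<^sub>v (x - y) = H *\<^sub>v (x - x') + H *\<^sub>v (x' - y)"
      using carr by (simp add: mult_add_distrib_mat_vec[OF H])
    then have "vec_norm2 (H *\<^sub>v (x - y)) \<le> vec_norm2 (H *\<^sub>v (x - x')) + vec_norm2 (H *\<^sub>v (x' - y))"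
      using carr by (auto intro!: vec_norm2_add[of _ q] mult_mat_vec_carrier[OF H])
    also have "\<dots> \<le> 2 * sqrt (X k / S k) * u + 2 * (\<Sum>i=r..<k. sqrt (X i / S i)) * u"
      using 1 step.IH[OF _ x'] k by simp
    also have "\<dots> = 2 * (\<Sum>i=r..<Suc k. sqrt (X i / S i)) * u"
      using step.hyps by (simp add: algebra_simps)
    finally show ?case .
  }
qed

subsection \<open>Dissipation inequalities from the Riccati equations\<close>

text \<open>The Riccati equation is applied to \<open>v\<close> and paired with \<open>v\<close>. As
  \<open>P\<close> is symmetric, the two terms linear in \<open>P\<close> contribute equally, and
  the other two become squared norms.\<close>

lemma control_riccati_rip:
  assumes A: "A \<in> carrier_mat n n" and B: "B \<in> carrier_mat n m" and C: "C \<in> carrier_mat q n"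
    and P: "P \<in> carrier_mat n n" "P\<^sup>T = P"
    and eq: "A\<^sup>T * P + P * A - P * B * B\<^sup>T * P + C\<^sup>T * C = 0\<^sub>m n n"
    and v: "v \<in> carrier_vec n"
  shows "2 * rip (cmat A *\<^sub>v v) (cmat P *\<^sub>v v) =
    rip (cmat (B\<^sup>T * P) *\<^sub>v v) (cmat (B\<^sup>T * P) *\<^sub>v v) - rip (cmat C *\<^sub>v v) (cmat C *\<^sub>v v)"
proof -
  define s where "s = cmat P *\<^sub>v v"
  define \<beta> where "\<beta> = cmat B\<^sup>T *\<^sub>v s"
  have s: "s \<in> carrier_vec n" unfolding s_def using P v by auto
  have \<beta>: "\<beta> \<in> carrier_vec m" unfolding \<beta>_def using B s by auto
  have carr: "A\<^sup>T \<in> carrier_mat n n" "B\<^sup>T \<in> carrier_mat m n" "C\<^sup>T \<in> carrier_mat n q"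
    using A B C P by auto
  have prods: "A\<^sup>T * P \<in> carrier_mat n n" "P * A \<in> carrier_mat n n" "B\<^sup>T * P \<in> carrier_mat m n"
    "B * (B\<^sup>T * P) \<in> carrier_mat n n" "P * (B * (B\<^sup>T * P)) \<in> carrier_mat n n" "C\<^sup>T * C \<in> carrier_mat n n"
    using A B C P by (simp_all add: mult_carrier_mat[of _ n n _ n] mult_carrier_mat[of _ m n _ n]
      mult_carrier_mat[of _ n m _ n] mult_carrier_mat[of _ n q _ n])
  \<comment> \<open>This bracketing lets the quadratic term act on \<open>v\<close> through the
    single vector \<open>\<beta>\<close>.\<close>
  have "P * B * B\<^sup>T * P = P * (B * (B\<^sup>T * P))"
    using assoc_mult_mat[of "P * B" n m "B\<^sup>T" n P n] assoc_mult_mat[of P n n B m "B\<^sup>T * P" n] B P(1) carr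
    by (simp del: assoc_mult_mat)
  then have expand: "cmat (A\<^sup>T * P + P * A - P * B * B\<^sup>T * P + C\<^sup>T * C) *\<^sub>v v =
    cmat A\<^sup>T *\<^sub>v s + cmat P *\<^sub>v (cmat A *\<^sub>v v) - cmat P *\<^sub>v (cmat B *\<^sub>v \<beta>) + cmat C\<^sup>T *\<^sub>v (cmat C *\<^sub>v v)"
    unfolding \<beta>_def s_def
    by (simp only: cmat_add_vec[OF minus_carrier_mat[OF prods(5)] prods(6) v]
      cmat_minus_vec[OF add_carrier_mat[OF prods(2)] prods(5) v] cmat_add_vec[OF prods(1,2) v]
      cmat_mult_vec[OF carr(1) P(1) v] cmat_mult_vec[OF P(1) A v] cmat_mult_vec[OF P(1) prods(4) v]
      cmat_mult_vec[OF B prods(3) v] cmat_mult_vec[OF carr(2) P(1) v] cmat_mult_vec[OF carr(3) C v])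
  have zero: "cmat (0\<^sub>m n n) *\<^sub>v v = 0\<^sub>v n" using v by (intro eq_vecI) (auto simp: scalar_prod_def)
  have "rip (cmat A\<^sup>T *\<^sub>v s + cmat P *\<^sub>v (cmat A *\<^sub>v v) - cmat P *\<^sub>v (cmat B *\<^sub>v \<beta>) + cmat C\<^sup>T *\<^sub>v (cmat C *\<^sub>v v)) v = 0"
    unfolding expand[symmetric] eq zero using v by (simp add: wip_def)
  moreover have "rip (cmat A\<^sup>T *\<^sub>v s) v = rip (cmat A *\<^sub>v v) s"
    using A s v by (subst rip_adjoint[of _ n n]) (auto intro: wip_commute)
  moreover have "rip (cmat P *\<^sub>v (cmat A *\<^sub>v v)) v = rip (cmat A *\<^sub>v v) s"
    using A s v P by (subst rip_adjoint[of _ n n]) (auto simp: s_def)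
  moreover have "rip (cmat P *\<^sub>v (cmat B *\<^sub>v \<beta>)) v = rip \<beta> \<beta>"
  proof -
    have "rip (cmat P *\<^sub>v (cmat B *\<^sub>v \<beta>)) v = rip (cmat B *\<^sub>v \<beta>) s"
      using B \<beta> v P by (subst rip_adjoint[of _ n n]) (auto simp: s_def)
    also have "\<dots> = rip \<beta> \<beta>"
      using B \<beta> s by (subst rip_adjoint[of _ n m]) (auto simp: \<beta>_def)
    finally show ?thesis .
  qed
  moreover have "rip (cmat C\<^sup>T *\<^sub>v (cmat C *\<^sub>v v)) v = rip (cmat C *\<^sub>v v) (cmat C *\<^sub>v v)"
    using C v by (subst rip_adjoint[of _ n q]) auto
  moreover have "cmat (B\<^sup>T * P) *\<^sub>v v = \<beta>"
    unfolding \<beta>_def s_def using carr P v by (simp add: cmat_mult_vec[of _ m n _ n] del: assoc_mult_mat_vec)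
  ultimately show ?thesis
    using A B C P v s \<beta> carr unfolding s_def[symmetric]
    by (simp add: wip_add_left[of _ n] wip_diff_left[of _ n])
qed

lemma closed_loop_mult_vec:
  assumes "A \<in> carrier_mat n n" "B \<in> carrier_mat n m" "P \<in> carrier_mat n n" "v \<in> carrier_vec n"
  shows "cmat (closed_loop A B P) *\<^sub>v v = cmat A *\<^sub>v v - cmat B *\<^sub>v (cmat (B\<^sup>T * P) *\<^sub>v v)"
proof -
  have "closed_loop A B P = A - B * (B\<^sup>T * P)"
    unfolding closed_loop_def using assms by (simp add: assoc_mult_mat[of _ n m _ n _ n])
  then show ?thesis
    using assms by (simp add: cmat_minus_vec[of _ n n] cmat_mult_vec[of _ n m _ n] del: assoc_mult_mat_vec)
qed

text \<open>For real \<open>M\<close> the products of real with imaginary parts only enter the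
  imaginary part of the form. Definiteness assumed on real vectors thus passes to complex
  ones.\<close>

lemma rip_real_parts:
  assumes "M \<in> carrier_mat n n" "v \<in> carrier_vec n"
  shows "rip (cmat M *\<^sub>v v) v = map_vec Re v \<bullet> (M *\<^sub>v map_vec Re v) + map_vec Im v \<bullet> (M *\<^sub>v map_vec Im v)"
  using assms unfolding wip_def scalar_prod_def
  by (simp add: scalar_prod_def atLeast0LessThan sum.distrib mult.commute)

lemma sym_pos_semidef_rip:
  assumes "sym_pos_semidef M" "M \<in> carrier_mat n n" "v \<in> carrier_vec n"
  shows "0 \<le> rip (cmat M *\<^sub>v v) v"
  using assms unfolding rip_real_parts[OF assms(2,3)] sym_pos_semidef_def
  by (intro add_nonneg_nonneg) auto

lemma sym_pos_def_rip:
  assumes "sym_pos_def M" "M \<in> carrier_mat n n" "v \<in> carrier_vec n" "v \<noteq> 0\<^sub>v n"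
  shows "0 < rip (cmat M *\<^sub>v v) v"
proof -
  have nn: "0 \<le> w \<bullet> (M *\<^sub>v w) \<and> (w \<noteq> 0\<^sub>v n \<longrightarrow> 0 < w \<bullet> (M *\<^sub>v w))" if "w \<in> carrier_vec n" for w
    using that assms(1,2) unfolding sym_pos_def_def by (cases "w = 0\<^sub>v n") (auto intro: less_imp_le)
  have "map_vec Re v \<noteq> 0\<^sub>v n \<or> map_vec Im v \<noteq> 0\<^sub>v n"
  proof (rule ccontr)
    assume "\<not> ?thesis"
    then have "map_vec Re v = 0\<^sub>v n" "map_vec Im v = 0\<^sub>v n" by auto
    then have "map_vec Re v $ i = 0 \<and> map_vec Im v $ i = 0" if "i < n" for i using that by simp
    then have "v = 0\<^sub>v n" using assms(3) by (intro eq_vecI) (auto simp: complex_eq_iff)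
    with assms(4) show False by simp
  qed
  then show ?thesis
    unfolding rip_real_parts[OF assms(2,3)]
    using nn[of "map_vec Re v"] nn[of "map_vec Im v"] assms(3)
    by (auto intro: add_pos_nonneg add_nonneg_pos)
qed

text \<open>Moving \<open>M\<close> to the other argument changes the sign, while symmetry of the
  form preserves the value.\<close>

lemma rip_skew:
  assumes "M \<in> carrier_mat n n" "M\<^sup>T = - M" "v \<in> carrier_vec n"
  shows "rip (cmat M *\<^sub>v v) v = 0"
proof -
  have "cmat (- M) *\<^sub>v v = - (cmat M *\<^sub>v v)"
    using assms by (intro eq_vecI) (auto simp: scalar_prod_def sum_negf)
  then have "rip (cmat M *\<^sub>v v) v = rip v (- (cmat M *\<^sub>v v))"
    using rip_adjoint[OF assms(1,3,3)] assms by simp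
  also have "\<dots> = rip (- (cmat M *\<^sub>v v)) v" using assms by (intro wip_commute) auto
  also have "\<dots> = - rip (cmat M *\<^sub>v v) v" using assms by (intro wip_uminus_left[of _ n]) auto
  finally show ?thesis by simp
qed

text \<open>Completing the square: with \<open>\<beta>\<close> and \<open>\<gamma>\<close> as in the
  proof, the right side minus the left side is the squared norm of
  \<open>\<beta> + \<gamma> - 2u\<close> minus \<open>2 * rip (cmat A *\<^sub>v v) q\<close>. The
  latter is nonpositive, as the skew part \<open>J\<close> does no work and \<open>R\<close>
  dissipates.\<close>

lemma filter_dissipation:
  assumes J: "J \<in> carrier_mat n n" "J\<^sup>T = - J" and R: "R \<in> carrier_mat n n" "sym_pos_semidef R"
    and Q: "Q \<in> carrier_mat n n" "Q\<^sup>T = Q" and B: "B \<in> carrier_mat n m"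
    and A: "A = (J - R) * Q" and C: "C = B\<^sup>T * Q"
    and P: "P \<in> carrier_mat n n" "P\<^sup>T = P"
    and eq: "A\<^sup>T * P + P * A - P * B * B\<^sup>T * P + C\<^sup>T * C = 0\<^sub>m n n"
    and v: "v \<in> carrier_vec n" and u: "u \<in> carrier_vec m"
  shows "2 * rip (cmat (closed_loop A B P) *\<^sub>v v + 2 \<cdot>\<^sub>v (cmat B *\<^sub>v u)) (cmat (Q + P) *\<^sub>v v) \<le> 4 * rip u u"
proof -
  define q s \<beta> \<gamma> where "q = cmat Q *\<^sub>v v" and "s = cmat P *\<^sub>v v"
    and "\<beta> = cmat (B\<^sup>T * P) *\<^sub>v v" and "\<gamma> = cmat C *\<^sub>v v"
  have carrA: "A \<in> carrier_mat n n" "C \<in> carrier_mat m n" "J - R \<in> carrier_mat n n"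
    unfolding A C using J R Q B by (auto intro!: mult_carrier_mat[of _ _ n])
  have carr: "q \<in> carrier_vec n" "s \<in> carrier_vec n" "\<beta> \<in> carrier_vec m" "\<gamma> \<in> carrier_vec m"
    unfolding q_def s_def \<beta>_def \<gamma>_def using Q P B carrA v
    by (auto intro!: mult_mat_vec_carrier[of _ _ n] mult_carrier_mat[of _ _ n])
  \<comment> \<open>Since \<open>C = B\<^sup>T * Q\<close>, the sum
    \<open>\<beta> + \<gamma>\<close> is \<open>B\<^sup>T * (Q + P)\<close> applied to
    \<open>v\<close>.\<close>
  have \<beta>: "\<beta> = cmat B\<^sup>T *\<^sub>v s" and \<gamma>: "\<gamma> = cmat B\<^sup>T *\<^sub>v q"
    unfolding \<beta>_def \<gamma>_def s_def q_def C using B P Q v by (simp_all only: cmat_mult_vec[of _ m n _ n] transpose_carrier_mat)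
  have Av: "cmat A *\<^sub>v v = cmat J *\<^sub>v q - cmat R *\<^sub>v q"
    unfolding A q_def using carrA(3) Q(1) J(1) R(1) v
    by (simp only: cmat_mult_vec[of _ n n _ n] cmat_minus_vec[of _ n n] mult_mat_vec_carrier[of _ n n] map_carrier_mat)
  have Bq: "rip (cmat B *\<^sub>v w) q = rip w \<gamma>" and Bs: "rip (cmat B *\<^sub>v w) s = rip w \<beta>"
    if "w \<in> carrier_vec m" for w
    using that B carr unfolding \<beta> \<gamma> by (simp_all only: rip_adjoint[of B n m])
  have Av_car: "cmat A *\<^sub>v v \<in> carrier_vec n" and B_car: "\<And>w. w \<in> carrier_vec m \<Longrightarrow> cmat B *\<^sub>v w \<in> carrier_vec n"
    and JR_car: "cmat J *\<^sub>v q \<in> carrier_vec n" "cmat R *\<^sub>v q \<in> carrier_vec n"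
    using carrA B J R v carr by (auto intro!: mult_mat_vec_carrier[of _ _ n] mult_mat_vec_carrier[of _ _ m])
  have storage_q: "rip (cmat A *\<^sub>v v) q \<le> 0"
    unfolding Av using wip_diff_left[OF JR_car carr(1)] rip_skew[OF J carr(1)]
      sym_pos_semidef_rip[OF R(2,1) carr(1)] by simp
  have storage_s: "2 * rip (cmat A *\<^sub>v v) s = rip \<beta> \<beta> - rip \<gamma> \<gamma>"
    unfolding s_def \<beta>_def \<gamma>_def by (rule control_riccati_rip[OF carrA(1) B carrA(2) P eq v])
  have loop: "cmat (closed_loop A B P) *\<^sub>v v = cmat A *\<^sub>v v - cmat B *\<^sub>v \<beta>"
    unfolding \<beta>_def by (rule closed_loop_mult_vec[OF carrA(1) B P(1) v])
  have two: "2 \<cdot>\<^sub>v (cmat B *\<^sub>v u) = cmat B *\<^sub>v u + cmat B *\<^sub>v u"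
    using B by (intro eq_vecI) auto
  have QP: "cmat (Q + P) *\<^sub>v v = q + s"
    unfolding q_def s_def by (rule cmat_add_vec[OF Q(1) P(1) v])
  have sum: "rip (cmat (closed_loop A B P) *\<^sub>v v + 2 \<cdot>\<^sub>v (cmat B *\<^sub>v u)) (cmat (Q + P) *\<^sub>v v) =
    rip (cmat A *\<^sub>v v) q + rip (cmat A *\<^sub>v v) s - rip \<beta> \<gamma> - rip \<beta> \<beta> + 2 * rip u \<gamma> + 2 * rip u \<beta>"
    unfolding loop two QP using Av_car B_car carr u Bq[OF carr(3)] Bs[OF carr(3)] Bq[OF u] Bs[OF u]
    by (simp add: wip_add_left[of _ n] wip_add_right[of _ n] wip_diff_left[of _ n])
  have "0 \<le> rip (\<beta> + \<gamma> - (u + u)) (\<beta> + \<gamma> - (u + u))" by (rule wip_self_nonneg) simp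
  also have "\<dots> = rip \<beta> \<beta> + rip \<gamma> \<gamma> + 2 * rip \<beta> \<gamma> - 4 * rip u \<gamma> - 4 * rip u \<beta> + 4 * rip u u"
    using carr u wip_commute[of \<gamma> \<beta>] wip_commute[of \<gamma> u] wip_commute[of \<beta> u]
    by (simp add: wip_add_left[of _ m] wip_add_right[of _ m] wip_diff_left[of _ m] wip_diff_right[of _ m])
  finally show ?thesis using storage_q storage_s unfolding sum by (simp add: algebra_simps)
qed

subsection \<open>The stabilizing solution of the filter equation\<close>

text \<open>Schur triangularization of \<open>Z\<close> turns the equation into
  \<open>K * F = F * T\<close> with \<open>T\<close> upper triangular. Column by column,
  \<open>F\<close> would have to consist of eigenvectors of \<open>K\<close> for eigenvalues of
  \<open>Z\<close>.\<close>

lemma sylvester_eq_0: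
  fixes K Z E :: "complex mat"
  assumes K: "K \<in> carrier_mat n n" and Z: "Z \<in> carrier_mat n n" and E: "E \<in> carrier_mat n n"
    and eq: "K * E = E * Z" and disj: "\<And>l. eigenvalue Z l \<Longrightarrow> \<not> eigenvalue K l"
  shows "E = 0\<^sub>m n n"
proof -
  obtain es where "char_poly Z = (\<Prod>a\<leftarrow>es. [:- a, 1:])" using char_poly_factorized[OF Z] by blast
  then obtain T where T: "T \<in> carrier_mat n n" "upper_triangular T" "similar_mat Z T"
    using schur_decomposition_exists[OF Z] by blast
  then obtain S S' where wit: "similar_mat_wit Z T S S'" unfolding similar_mat_def by blast
  note SS = similar_mat_witD2[OF Z wit]
  define F where "F = E * S"
  have F: "F \<in> carrier_mat n n" unfolding F_def using E SS by auto
  have "K * F = E * Z * S"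
    unfolding F_def using eq assoc_mult_mat[OF K E SS(6)] by simp
  also have "\<dots> = E * (S * T * S' * S)"
    using assoc_mult_mat[OF E Z SS(6)] SS(3) by simp
  also have "S * T * S' * S = S * T"
  proof -
    have ST: "S * T \<in> carrier_mat n n" using SS by auto
    show ?thesis using assoc_mult_mat[OF ST SS(7,6)] SS(2) right_mult_one_mat[OF ST] by simp
  qed
  also have "E * (S * T) = F * T"
    unfolding F_def using assoc_mult_mat[OF E SS(6) T(1)] by simp
  finally have KF: "K * F = F * T" .
  have eig: "eigenvalue Z (T $$ (j, j))" if "j < n" for j
  proof -
    have "T $$ (j, j) \<in> set (diag_mat T)" using that T(1) unfolding diag_mat_def by auto
    then have "poly (char_poly T) (T $$ (j, j)) = 0"
      unfolding char_poly_upper_triangular[OF T(1,2)] by (induction "diag_mat T") (auto simp: poly_prod_list prod_list_zero_iff)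
    then show ?thesis
      unfolding eigenvalue_root_char_poly[OF Z] char_poly_similar[OF T(3)] .
  qed
  have col0: "col F j = 0\<^sub>v n" if "j < n" for j
    using that
  proof (induction j rule: less_induct)
    \<comment> \<open>Earlier columns of \<open>F\<close> vanish by induction and entries of
      \<open>T\<close> below the diagonal are 0, so only the diagonal entry survives in column
      \<open>j\<close> of \<open>F * T\<close>.\<close>
    case (less j)
    have "K *\<^sub>v col F j = col (F * T) j"
      using col_mult2[OF K F less.prems] KF by simp
    also have "\<dots> = T $$ (j, j) \<cdot>\<^sub>v col F j"
    proof (rule eq_vecI)
      fix i assume "i < dim_vec (T $$ (j, j) \<cdot>\<^sub>v col F j)"
      then have i: "i < n" using F by simp
      have "F $$ (i, l) * T $$ (l, j) = 0" if "l < n" "l \<noteq> j" for l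
      proof (cases "l < j")
        case True
        then have "col F l $ i = 0" using less.IH[of l] that i by simp
        then show ?thesis using that i F by simp
      next
        case False
        then show ?thesis using that T less.prems by (simp add: upper_triangularD)
      qed
      then have "(\<Sum>l<n. F $$ (i, l) * T $$ (l, j)) = (\<Sum>l\<in>{j}. F $$ (i, l) * T $$ (l, j))"
        using less.prems by (intro sum.mono_neutral_right) auto
      then show "col (F * T) j $ i = (T $$ (j, j) \<cdot>\<^sub>v col F j) $ i"
        using i less.prems F T by (simp add: scalar_prod_def atLeast0LessThan)
    qed (use F T in auto)
    finally have "K *\<^sub>v col F j = T $$ (j, j) \<cdot>\<^sub>v col F j" .
    then show ?case
      using disj[OF eig[OF less.prems]] K F less.prems unfolding eigenvalue_def eigenvector_def
      by (metis carrier_matD(1) col_dim carrier_vec_dim_vec)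
  qed
  have "F = 0\<^sub>m n n"
  proof (rule eq_matI)
    fix i j assume "i < dim_row (0\<^sub>m n n :: complex mat)" "j < dim_col (0\<^sub>m n n :: complex mat)"
    then show "F $$ (i, j) = 0\<^sub>m n n $$ (i, j)"
      using arg_cong[OF col0[of j], of "\<lambda>v. v $ i"] F by simp
  qed (use F in auto)
  then have "E * (S * S') = 0\<^sub>m n n"
    using assoc_mult_mat[OF E SS(6,7)] SS(7) unfolding F_def by simp
  then show ?thesis using SS(1) right_mult_one_mat[OF E] by simp
qed

text \<open>\<open>E\<close> is \<open>(P - Q\<^sup>-\<^sup>1) * Q\<close>. It solves a Sylvester
  equation between the stable \<open>K\<close> and \<open>W * Q\<close>, whose eigenvalues have
  nonnegative real part. Up to similarity, \<open>W * Q\<close> is minus the transposed closed loop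
  of the solution \<open>Q\<^sup>-\<^sup>1\<close>.\<close>

lemma filter_riccati_solution_inverse:
  assumes J: "J \<in> carrier_mat n n" "J\<^sup>T = - J" and R: "R \<in> carrier_mat n n" "sym_pos_semidef R"
    and Q: "Q \<in> carrier_mat n n" "sym_pos_def Q" and B: "B \<in> carrier_mat n m"
    and A: "A = (J - R) * Q" and C: "C = B\<^sup>T * Q"
    and ric: "filter_riccati_stabilizing A B C R P"
  shows "P * Q = 1\<^sub>m n"
proof -
  define G where "G = B * B\<^sup>T"
  define W where "W = J + R + G"
  define K where "K = A - P * C\<^sup>T * C"
  define E where "E = P * Q - 1\<^sub>m n"
  have RT: "R\<^sup>T = R" and QT: "Q\<^sup>T = Q"
    using R(2) Q(2) unfolding sym_pos_semidef_def sym_pos_def_def by auto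
  have A_car: "A \<in> carrier_mat n n" and C_car: "C \<in> carrier_mat m n" and G: "G \<in> carrier_mat n n"
    unfolding A C G_def using J R Q B minus_carrier_mat[OF R(1), of J] mult_carrier_mat[of "J - R" n n Q n] mult_carrier_mat[of "B\<^sup>T" m n Q n]
      mult_carrier_mat[of B n m "B\<^sup>T" n] by simp_all
  have W: "W \<in> carrier_mat n n" unfolding W_def using J R G by auto
  from ric A_car have P: "P \<in> carrier_mat n n"
    and eq: "A * P + P * A\<^sup>T - P * C\<^sup>T * C * P + B * B\<^sup>T + 2 \<cdot>\<^sub>m R = 0\<^sub>m n n"
    and stable: "stable_mat K"
    unfolding filter_riccati_stabilizing_def K_def by auto
  have CT: "C\<^sup>T = Q * B" unfolding C using B Q QT by (simp add: transpose_mult[of _ m n])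
  have PCC: "P * C\<^sup>T * C = P * (Q * (G * Q))"
    unfolding CT G_def unfolding C using P Q B
    by (simp add: assoc_mult_mat[of P n n Q n] assoc_mult_mat[of P n n "Q * B" m _ n]
      assoc_mult_mat[of Q n n B m _ n] assoc_mult_mat[of B n m "B\<^sup>T" n Q n] mult_carrier_mat[of _ n n _ m]
      mult_carrier_mat[of _ m n _ n])
  have PAT: "P * A\<^sup>T = - (P * (Q * (J + R)))"
  proof -
    have "A\<^sup>T = Q * (J - R)\<^sup>T" unfolding A using J R Q QT by (simp add: transpose_mult[of _ n n] minus_carrier_mat)
    also have "(J - R)\<^sup>T = - (J + R)" using J R RT by (simp add: transpose_minus) (auto intro!: eq_matI)
    finally show ?thesis using J R Q P by simp
  qed
  have AJR: "A = J * Q - R * Q"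
    unfolding A by (rule minus_mult_distrib_mat[OF J(1) R(1) Q(1)])
  note carr = mult_carrier_mat[of _ n n _ n] add_carrier_mat minus_carrier_mat uminus_carrier_mat one_carrier_mat
  note expand = add_mult_distrib_mat[of _ n n _ _ n] minus_mult_distrib_mat[of _ n n _ _ n]
    mult_add_distrib_mat[of _ n n _ n] mult_minus_distrib_mat[of _ n n _ n] assoc_mult_mat[of _ n n _ n _ n]
    left_mult_one_mat[of _ n n] right_mult_one_mat[of _ n n]
  have K: "K \<in> carrier_mat n n" and E: "E \<in> carrier_mat n n" and Z: "W * Q \<in> carrier_mat n n"
    unfolding K_def E_def PCC using A_car P G Q W by (simp_all add: carr)
  \<comment> \<open>The Riccati equation times \<open>Q\<close> from the right, fully expanded, is
    exactly the difference of the two sides, which is then compared entrywise.\<close>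
  have KE: "K * E = E * (W * Q)"
  proof -
    have "2 \<cdot>\<^sub>m R = R + R" using R(1) by (intro eq_matI) auto
    moreover have "A * P + - (P * (Q * (J + R))) = A * P - P * (Q * (J + R))"
      using A_car P Q J R by (intro eq_matI) (simp_all del: index_mult_mat(1))
    ultimately have "A * P - P * (Q * (J + R)) - P * (Q * (G * Q)) * P + G + (R + R) = 0\<^sub>m n n"
      using eq unfolding PAT PCC G_def[symmetric] by simp
    then have "(A * P - P * (Q * (J + R)) - P * (Q * (G * Q)) * P + G + (R + R)) * Q = 0\<^sub>m n n"
      using Q(1) by simp
    then have 1: "J * (Q * (P * Q)) - R * (Q * (P * Q)) - (P * (Q * (J * Q)) + P * (Q * (R * Q))) -
      P * (Q * (G * (Q * (P * Q)))) + G * Q + (R * Q + R * Q) = 0\<^sub>m n n"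
      unfolding AJR using P Q(1) J(1) R(1) G by (simp add: expand carr)
    have 2: "K * E = J * (Q * (P * Q)) - R * (Q * (P * Q)) - P * (Q * (G * (Q * (P * Q)))) -
       (J * Q - R * Q - P * (Q * (G * Q)))"
      unfolding K_def PCC AJR E_def using P Q(1) J(1) R(1) G by (simp add: expand carr)
    have 3: "E * (W * Q) = P * (Q * (J * Q)) - J * Q + (P * (Q * (R * Q)) - R * Q + (P * (Q * (G * Q)) - G * Q))"
      unfolding E_def W_def using P Q(1) J(1) R(1) G by (simp add: expand carr)
    show ?thesis
    proof (rule eq_matI)
      fix i j assume "i < dim_row (E * (W * Q))" "j < dim_col (E * (W * Q))"
      then have "i < n" "j < n" using E Z by auto
      with arg_cong[OF 1, of "\<lambda>M. M $$ (i, j)"] show "(K * E) $$ (i, j) = (E * (W * Q)) $$ (i, j)"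
        unfolding 2 3 using P Q(1) J(1) R(1) G by (simp del: index_mult_mat(1))
    qed (use K E Z in auto)
  qed
  have cK: "cmat K * cmat E = cmat E * cmat (W * Q)"
    using of_real_hom.mat_hom_mult[OF K E] of_real_hom.mat_hom_mult[OF E Z] KE by metis
  have "cmat E = 0\<^sub>m n n"
  proof (rule sylvester_eq_0[OF _ _ _ cK])
    \<comment> \<open>Pairing the eigenvector equation with \<open>q\<close> gives
      \<open>Re l * rip v q\<close> on one side. On the other, \<open>J\<close> drops out while
      \<open>R\<close> and \<open>B\<close> contribute nonnegative terms.\<close>
    fix l assume "eigenvalue (cmat (W * Q)) l"
    then obtain v where v: "v \<in> carrier_vec n" "v \<noteq> 0\<^sub>v n" and Zv: "cmat (W * Q) *\<^sub>v v = l \<cdot>\<^sub>v v"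
      using Z unfolding eigenvalue_def eigenvector_def by auto
    define q where "q = cmat Q *\<^sub>v v"
    have q: "q \<in> carrier_vec n" unfolding q_def using Q v by auto
    have "l \<cdot>\<^sub>v v = cmat W *\<^sub>v q"
      unfolding q_def Zv[symmetric] by (rule cmat_mult_vec[OF W Q(1) v(1)])
    also have "\<dots> = cmat J *\<^sub>v q + cmat R *\<^sub>v q + cmat B *\<^sub>v (cmat B\<^sup>T *\<^sub>v q)"
      unfolding W_def G_def using J(1) R(1) B q
      by (simp only: cmat_add_vec[of _ n n] cmat_mult_vec[of _ n m _ n] add_carrier_mat mult_carrier_mat[of _ n m _ n] transpose_carrier_mat)
    finally have "rip (l \<cdot>\<^sub>v v) q = rip (cmat J *\<^sub>v q) q + rip (cmat R *\<^sub>v q) q + rip (cmat B *\<^sub>v (cmat B\<^sup>T *\<^sub>v q)) q"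
      using J(1) R(1) B q by (simp add: wip_add_left[of _ n])
    also have "rip (cmat B *\<^sub>v (cmat B\<^sup>T *\<^sub>v q)) q = rip (cmat B\<^sup>T *\<^sub>v q) (cmat B\<^sup>T *\<^sub>v q)"
      using B q by (subst rip_adjoint[of B n m]) auto
    finally have ge: "0 \<le> rip (l \<cdot>\<^sub>v v) q"
      using rip_skew[OF J q] sym_pos_semidef_rip[OF R(2,1) q] wip_self_nonneg[of "cmat B\<^sup>T *\<^sub>v q" "\<lambda>_. 1"] by simp
    have qv: "rip q v = rip v q" using q v by (intro wip_commute) auto
    have "rip (l \<cdot>\<^sub>v v) q = Re l * rip v q"
    proof -
      \<comment> \<open>The Hermitian form of the real symmetric \<open>Q\<close> takes real values,
        so the imaginary part of \<open>l\<close> does not contribute.\<close>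
      have "rip (\<i> \<cdot>\<^sub>v v) q = 0"
      proof -
        have "rip (\<i> \<cdot>\<^sub>v v) q = rip (cmat Q *\<^sub>v (\<i> \<cdot>\<^sub>v v)) v"
          unfolding q_def using Q v QT by (subst rip_adjoint[of Q n n]) auto
        also have "cmat Q *\<^sub>v (\<i> \<cdot>\<^sub>v v) = \<i> \<cdot>\<^sub>v q"
          unfolding q_def using Q v by (simp add: mult_mat_vec[of _ n n])
        also have "rip (\<i> \<cdot>\<^sub>v q) v = - rip (\<i> \<cdot>\<^sub>v v) q"
          unfolding wip_def using q v by (simp add: sum_negf[symmetric] algebra_simps)
        finally show ?thesis by simp
      qed
      moreover have "l \<cdot>\<^sub>v v = complex_of_real (Re l) \<cdot>\<^sub>v v + complex_of_real (Im l) \<cdot>\<^sub>v (\<i> \<cdot>\<^sub>v v)"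
        by (intro eq_vecI) (auto simp: complex_eq_iff)
      ultimately show ?thesis
        using v q by (simp add: wip_add_left[of _ n] wip_smult_left[of _ n])
    qed
    moreover have "0 < rip v q" using sym_pos_def_rip[OF Q(2,1) v] qv unfolding q_def by simp
    ultimately have "0 \<le> Re l" using ge by (simp add: zero_le_mult_iff)
    then show "\<not> eigenvalue (cmat K) l" using stable unfolding stable_mat_def by fastforce
  qed (use K E Z in auto)
  have "E = 0\<^sub>m n n"
  proof (rule eq_matI)
    fix i j assume "i < dim_row (0\<^sub>m n n :: real mat)" "j < dim_col (0\<^sub>m n n :: real mat)"
    with arg_cong[OF \<open>cmat E = 0\<^sub>m n n\<close>, of "\<lambda>M. M $$ (i, j)"]
    show "E $$ (i, j) = 0\<^sub>m n n $$ (i, j)" using E by simp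
  qed (use E in auto)
  show ?thesis
  proof (rule eq_matI)
    fix i j assume "i < dim_row (1\<^sub>m n :: real mat)" "j < dim_col (1\<^sub>m n :: real mat)"
    with arg_cong[OF \<open>E = 0\<^sub>m n n\<close>, of "\<lambda>M. M $$ (i, j)"]
    show "(P * Q) $$ (i, j) = 1\<^sub>m n $$ (i, j)"
      unfolding E_def using P Q by (simp del: index_mult_mat(1))
  qed (use P Q in auto)
qed

subsection \<open>Coprime factors of truncated systems\<close>

lemma lead_block_self: "M \<in> carrier_mat p q \<Longrightarrow> lead_block p q M = M"
  by (intro eq_matI) auto

lemma mat_diag_transpose [simp]: "(mat_diag n f)\<^sup>T = mat_diag n f"
  unfolding mat_diag_def by (intro eq_matI) auto

lemma lead_block_mult_mat_diag:
  assumes "M \<in> carrier_mat nr n" "p \<le> nr" "k \<le> n"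
  shows "lead_block p k (M * mat_diag n f) = lead_block p k M * mat_diag k f"
  unfolding mat_diag_mult_right[OF assms(1)] mat_diag_mult_right[OF lead_block_carrier]
  using assms by (intro eq_matI) auto

text \<open>A diagonal matrix on the right only scales columns, so the leading block of the feedback
  term involves just the leading rows of \<open>B\<close>.\<close>

lemma lead_block_closed_loop:
  assumes A: "A \<in> carrier_mat n n" and B: "B \<in> carrier_mat n m" and k: "k \<le> n"
  shows "closed_loop (lead_block k k A) (lead_block k m B) (mat_diag k f) =
    lead_block k k (closed_loop A B (mat_diag n f))"
proof (rule eq_matI)
  fix i j assume "i < dim_row (lead_block k k (closed_loop A B (mat_diag n f)))"
    "j < dim_col (lead_block k k (closed_loop A B (mat_diag n f)))"
  then have ij: "i < k" "j < k" by auto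
  let ?B = "lead_block k m B"
  have BB: "?B * ?B\<^sup>T \<in> carrier_mat k k" "B * B\<^sup>T \<in> carrier_mat n n"
    using B mult_carrier_mat[of ?B k m "?B\<^sup>T" k] mult_carrier_mat[of B n m "B\<^sup>T" n] by auto
  show "closed_loop (lead_block k k A) ?B (mat_diag k f) $$ (i, j) =
    lead_block k k (closed_loop A B (mat_diag n f)) $$ (i, j)"
    using ij A B k unfolding closed_loop_def mat_diag_mult_right[OF BB(1)] mat_diag_mult_right[OF BB(2)]
    by (simp add: scalar_prod_def)
qed (auto simp: closed_loop_def mat_diag_def)

text \<open>The off-diagonal blocks of a diagonal matrix vanish, hence so does the Schur complement
  correction.\<close>

lemma ec_Q_mat_diag:
  assumes "r \<le> n"
  shows "ec_Q r (mat_diag n f) = mat_diag r f"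
  using assms unfolding ec_Q_def split_block_def Let_def
  by (intro eq_matI) (auto simp: mat_diag_def scalar_prod_def)

text \<open>Trades the resolvent for a state \<open>x\<close> solving the closed-loop equation, so
  that models can be compared through their states.\<close>

lemma rcf_mult_vec:
  assumes A: "A \<in> carrier_mat n n" and B: "B \<in> carrier_mat n m" and C: "C \<in> carrier_mat q n"
    and P: "P \<in> carrier_mat n n" and u: "u \<in> carrier_vec m"
    and det: "det (z \<cdot>\<^sub>m 1\<^sub>m n - cmat (closed_loop A B P)) \<noteq> 0"
  shows "\<exists>x \<in> carrier_vec n. (z \<cdot>\<^sub>m 1\<^sub>m n - cmat (closed_loop A B P)) *\<^sub>v x = cmat B *\<^sub>v u \<and>
    rcf A B C P z *\<^sub>v u = (u - cmat (B\<^sup>T * P) *\<^sub>v x) @\<^sub>v (cmat C *\<^sub>v x)"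
    and "rcf A B C P z \<in> carrier_mat (m + q) m"
proof -
  let ?M = "z \<cdot>\<^sub>m 1\<^sub>m n - cmat (closed_loop A B P)"
  have cl: "closed_loop A B P \<in> carrier_mat n n"
    unfolding closed_loop_def using A B P by (auto intro!: minus_carrier_mat mult_carrier_mat[of _ n n P n] mult_carrier_mat[of B n m])
  then have M: "?M \<in> carrier_mat n n" by (intro minus_carrier_mat) simp
  note inv = mat_inv_right[OF M det]
  have res: "resolvent_mat (closed_loop A B P) z = mat_inv ?M"
    unfolding resolvent_mat_def using cl by simp
  define x where "x = mat_inv ?M *\<^sub>v (cmat B *\<^sub>v u)"
  have Bu: "cmat B *\<^sub>v u \<in> carrier_vec n" using B u by auto
  have x: "x \<in> carrier_vec n" unfolding x_def by (rule mult_mat_vec_carrier[OF inv(1) Bu])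
  have sol: "?M *\<^sub>v x = cmat B *\<^sub>v u"
    unfolding x_def assoc_mult_mat_vec[OF M inv(1) Bu, symmetric] inv(2) using Bu by simp
  have BtP: "cmat (B\<^sup>T * P) \<in> carrier_mat m n" using B P by (auto intro!: mult_carrier_mat[of _ _ n])
  have act: "L * mat_inv ?M * cmat B \<in> carrier_mat p m"
    "(L * mat_inv ?M * cmat B) *\<^sub>v u = L *\<^sub>v x" if L: "L \<in> carrier_mat p n" for L :: "complex mat" and p
  proof -
    have Li: "L * mat_inv ?M \<in> carrier_mat p n" using L inv(1) by auto
    have cB: "cmat B \<in> carrier_mat n m" using B by simp
    show "L * mat_inv ?M * cmat B \<in> carrier_mat p m" using Li cB by (rule mult_carrier_mat)
    show "(L * mat_inv ?M * cmat B) *\<^sub>v u = L *\<^sub>v x"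
      unfolding x_def using assoc_mult_mat_vec[OF Li cB u] assoc_mult_mat_vec[OF L inv(1) Bu] by simp
  qed
  have N: "rcf_N A B C P z \<in> carrier_mat q m" "rcf_N A B C P z *\<^sub>v u = cmat C *\<^sub>v x"
    unfolding rcf_N_def res using act[of "cmat C" q] C by auto
  have Mr: "rcf_M A B P z \<in> carrier_mat m m" "rcf_M A B P z *\<^sub>v u = u - cmat (B\<^sup>T * P) *\<^sub>v x"
    unfolding rcf_M_def res using act[OF BtP] B u
    by (auto simp: minus_mult_distrib_mat_vec[of _ m m] intro: minus_carrier_mat)
  have "rcf A B C P z *\<^sub>v u = (u - cmat (B\<^sup>T * P) *\<^sub>v x) @\<^sub>v (cmat C *\<^sub>v x)"
    unfolding rcf_def by (simp only: mat_mult_append[OF Mr(1) N(1) u] Mr(2) N(2))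
  with x sol show "\<exists>x \<in> carrier_vec n. ?M *\<^sub>v x = cmat B *\<^sub>v u \<and>
    rcf A B C P z *\<^sub>v u = (u - cmat (B\<^sup>T * P) *\<^sub>v x) @\<^sub>v (cmat C *\<^sub>v x)" by blast
  show "rcf A B C P z \<in> carrier_mat (m + q) m"
    unfolding rcf_def using Mr(1) N(1) by (rule carrier_append_rows)
qed

text \<open>Padding the truncated state with zeros lets models of every order share the full closed
  loop and the full output matrices. It is used with \<open>k = n\<close> and
  \<open>k = r\<close>.\<close>

lemma rcf_lead_block:
  fixes \<sigma> :: "nat \<Rightarrow> real"
  assumes A: "A \<in> carrier_mat n n" and B: "B \<in> carrier_mat n m" and C: "C \<in> carrier_mat q n"
    and k: "k \<le> n" and u: "u \<in> carrier_vec m" and z: "0 < Re z"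
    and \<sigma>: "\<And>i. i < n \<Longrightarrow> 0 < \<sigma> i"
    and L1: "\<And>d. d \<in> carrier_vec n \<Longrightarrow> wip \<sigma> (cmat (closed_loop A B (mat_diag n \<sigma>)) *\<^sub>v d) d \<le> 0"
  shows "\<exists>x. trunc_response (cmat (closed_loop A B (mat_diag n \<sigma>))) (cmat B *\<^sub>v u) z k x \<and>
      rcf (lead_block k k A) (lead_block k m B) (lead_block q k C) (mat_diag k \<sigma>) z *\<^sub>v u =
        (u - cmat (B\<^sup>T * mat_diag n \<sigma>) *\<^sub>v x) @\<^sub>v (cmat C *\<^sub>v x)"
    and "rcf (lead_block k k A) (lead_block k m B) (lead_block q k C) (mat_diag k \<sigma>) z \<in> carrier_mat (m + q) m"
proof -
  let ?cl = "closed_loop A B (mat_diag n \<sigma>)"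
  have cl: "?cl \<in> carrier_mat n n"
    unfolding closed_loop_def using A B by (auto intro!: minus_carrier_mat mult_carrier_mat[of _ n n "mat_diag n \<sigma>" n] mult_carrier_mat[of B n m])
  then have ccl: "cmat ?cl \<in> carrier_mat n n" by simp
  have comm: "cmat (lead_block p c L) = lead_block p c (cmat L)" if "L \<in> carrier_mat nr nc" "p \<le> nr" "c \<le> nc" for p c L nr nc
    using that by (intro eq_matI) auto
  have det: "det (z \<cdot>\<^sub>m 1\<^sub>m k - cmat (closed_loop (lead_block k k A) (lead_block k m B) (mat_diag k \<sigma>))) \<noteq> 0"
    unfolding lead_block_closed_loop[OF A B k] comm[OF cl k k]
    using det_resolvent_nonzero[OF ccl k z] \<sigma> L1 by blast
  note app = rcf_mult_vec[OF lead_block_carrier lead_block_carrier lead_block_carrier mat_diag_dim u det]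
  show "rcf (lead_block k k A) (lead_block k m B) (lead_block q k C) (mat_diag k \<sigma>) z \<in> carrier_mat (m + q) m"
    by (rule app(2))
  obtain y where y: "y \<in> carrier_vec k"
    and sol: "(z \<cdot>\<^sub>m 1\<^sub>m k - lead_block k k (cmat ?cl)) *\<^sub>v y = cmat (lead_block k m B) *\<^sub>v u"
    and rcf: "rcf (lead_block k k A) (lead_block k m B) (lead_block q k C) (mat_diag k \<sigma>) z *\<^sub>v u =
      (u - cmat ((lead_block k m B)\<^sup>T * mat_diag k \<sigma>) *\<^sub>v y) @\<^sub>v (cmat (lead_block q k C) *\<^sub>v y)"
    using app(1)[of q C] unfolding lead_block_closed_loop[OF A B k] comm[OF cl k k] by blast
  define x where "x = y @\<^sub>v 0\<^sub>v (n - k)"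
  have Bu: "cmat B *\<^sub>v u \<in> carrier_vec n" using B u by auto
  have "cmat (lead_block k m B) *\<^sub>v u = vec_first (cmat B *\<^sub>v u) k"
    using B u k unfolding vec_first_def by (intro eq_vecI) (auto simp: scalar_prod_def)
  with sol have "trunc_response (cmat ?cl) (cmat B *\<^sub>v u) z k x"
    unfolding x_def by (intro trunc_response_append_zero[OF ccl Bu y k]) simp
  moreover have pad: "cmat (lead_block p k L) *\<^sub>v y = cmat L *\<^sub>v x" if L: "L \<in> carrier_mat p n" for L p
  proof (rule eq_vecI)
    fix i assume "i < dim_vec (cmat L *\<^sub>v x)"
    then have i: "i < p" using L by simp
    have "cmat L \<in> carrier_mat p n" using L by simp
    then show "(cmat (lead_block p k L) *\<^sub>v y) $ i = (cmat L *\<^sub>v x) $ i"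
      unfolding x_def comm[OF L order.refl k] using i by (intro lead_block_mult_vec[OF _ y k order.refl])
  qed (use L in auto)
  moreover have "(lead_block k m B)\<^sup>T * mat_diag k \<sigma> = lead_block m k (B\<^sup>T * mat_diag n \<sigma>)"
  proof -
    have "(lead_block k m B)\<^sup>T = lead_block m k B\<^sup>T" using B k by (intro eq_matI) auto
    then show ?thesis using B k by (simp add: lead_block_mult_mat_diag[of _ m n])
  qed
  moreover have "B\<^sup>T * mat_diag n \<sigma> \<in> carrier_mat m n" using B by (auto intro!: mult_carrier_mat[of _ _ n])
  ultimately show "\<exists>x. trunc_response (cmat ?cl) (cmat B *\<^sub>v u) z k x \<and>
      rcf (lead_block k k A) (lead_block k m B) (lead_block q k C) (mat_diag k \<sigma>) z *\<^sub>v u =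
        (u - cmat (B\<^sup>T * mat_diag n \<sigma>) *\<^sub>v x) @\<^sub>v (cmat C *\<^sub>v x)"
    using rcf pad[OF C] by (intro exI[of _ x]) simp
qed

section \<open>Norm estimate and diagonal inverses\<close>

lemma spectral_norm_le:
  assumes "\<And>v. v \<in> carrier_vec (dim_col M) \<Longrightarrow> vec_norm2 (M *\<^sub>v v) \<le> c * vec_norm2 v" "0 \<le> c"
  shows "spectral_norm M \<le> c"
  unfolding spectral_norm_def
proof (rule cSUP_least)
  have "0\<^sub>v (dim_col M) \<in> {v \<in> carrier_vec (dim_col M). vec_norm2 v \<le> 1}" by simp
  then show "{v \<in> carrier_vec (dim_col M). vec_norm2 v \<le> 1} \<noteq> {}" by blast
  fix v assume "v \<in> {v \<in> carrier_vec (dim_col M). vec_norm2 v \<le> 1}"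
  then show "vec_norm2 (M *\<^sub>v v) \<le> c"
    using assms(1)[of v] mult_left_mono[OF _ assms(2), of "vec_norm2 v" 1] by auto
qed

text \<open>Entrywise the product says that \<open>\<sigma> i * Q $$ (i, j)\<close> is 1 on the
  diagonal and 0 elsewhere. Positivity of \<open>\<sigma> i\<close> follows from that of
  \<open>Q $$ (i, i)\<close>, the quadratic form of \<open>Q\<close> at a unit vector.\<close>

lemma mat_diag_inverse_pos:
  fixes \<sigma> :: "nat \<Rightarrow> real"
  assumes Q: "Q \<in> carrier_mat n n" "sym_pos_def Q" and inv: "mat_diag n \<sigma> * Q = 1\<^sub>m n"
  shows "Q = mat_diag n (\<lambda>i. 1 / \<sigma> i)" and "\<And>i. i < n \<Longrightarrow> 0 < \<sigma> i"
proof -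
  have ent: "\<sigma> i * Q $$ (i, j) = (if i = j then 1 else 0)" if "i < n" "j < n" for i j
    using arg_cong[OF inv, of "\<lambda>M. M $$ (i, j)"] that mat_diag_mult_left[OF Q(1), of \<sigma>] by simp
  have ne: "\<sigma> i \<noteq> 0" if "i < n" for i using ent[OF that that] by auto
  show "Q = mat_diag n (\<lambda>i. 1 / \<sigma> i)"
  proof (rule eq_matI)
    fix i j assume "i < dim_row (mat_diag n (\<lambda>i. 1 / \<sigma> i))" "j < dim_col (mat_diag n (\<lambda>i. 1 / \<sigma> i))"
    then have ij: "i < n" "j < n" by (auto simp: mat_diag_def)
    then show "Q $$ (i, j) = mat_diag n (\<lambda>i. 1 / \<sigma> i) $$ (i, j)"
      using ent[OF ij] ne[OF ij(1)] by (auto simp: mat_diag_def field_simps split: if_splits)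
  qed (use Q in \<open>auto simp: mat_diag_def\<close>)
  fix i assume i: "i < n"
  have "unit_vec n i $ i = (1 :: real)" using i by simp
  then have "unit_vec n i \<noteq> (0\<^sub>v n :: real vec)" using i by (metis index_zero_vec(1) zero_neq_one)
  then have "0 < unit_vec n i \<bullet> (Q *\<^sub>v unit_vec n i)"
    using Q unfolding sym_pos_def_def by auto
  then have "0 < Q $$ (i, i)" using Q(1) i by simp
  moreover have "0 < \<sigma> i * Q $$ (i, i)" using ent[OF i i] by simp
  ultimately show "0 < \<sigma> i" by (simp add: zero_less_mult_iff)
qed

section \<open>Error bound for the coprime factors of the reduced model\<close>

theorem theorem8:
  fixes n m r :: nat
    and J R Q A B C Pc Pf :: "real mat"
    and \<sigma> :: "nat \<Rightarrow> real"
  assumes "J \<in> carrier_mat n n" and "R \<in> carrier_mat n n" and "Q \<in> carrier_mat n n"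
    and "B \<in> carrier_mat n m"
    and "J\<^sup>T = - J" and "sym_pos_semidef R" and "sym_pos_def Q"
    and "A = (J - R) * Q" and "C = B\<^sup>T * Q"
    and "controllable A B" and "observable A C"
    and "control_riccati_stabilizing A B C Pc"
    and "filter_riccati_stabilizing A B C R Pf"
    and "Pc = mat_diag n \<sigma>" and "Pf = mat_diag n \<sigma>"
    and "r \<le> n"
  shows "hinf_norm (\<lambda>s. rcf A B C Pc s - rcf (ec_A r J R Q) (ec_B r B) (ec_C r Q B) (mat_diag r \<sigma>) s)
           \<le> ereal (2 * (\<Sum>i = r..<n. \<sigma> i / sqrt (1 + (\<sigma> i)\<^sup>2)))"
proof -
  let ?P = "mat_diag n \<sigma>"
  note J = assms(1,5) and R = assms(2,6) and Q = assms(3,7) and B = assms(4) and rn = assms(16)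
  have PQ: "?P * Q = 1\<^sub>m n"
    using filter_riccati_solution_inverse[OF J R Q B assms(8,9,13)] assms(15) by simp
  note Qdiag = mat_diag_inverse_pos(1)[OF Q PQ] and \<sigma> = mat_diag_inverse_pos(2)[OF Q PQ]
  have JR: "J - R \<in> carrier_mat n n" using R(1) by (rule minus_carrier_mat)
  have A: "A \<in> carrier_mat n n" and C: "C \<in> carrier_mat m n"
    unfolding assms(8,9) using JR Q(1) B by (auto intro: mult_carrier_mat)
  have ric: "A\<^sup>T * ?P + ?P * A - ?P * B * B\<^sup>T * ?P + C\<^sup>T * C = 0\<^sub>m n n"
    using assms(12,14) A unfolding control_riccati_stabilizing_def by auto
  have P: "?P \<in> carrier_mat n n" "?P\<^sup>T = ?P" by auto
  define cl where "cl = closed_loop A B ?P"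
  define K where "K = B\<^sup>T * ?P"
  have K: "K \<in> carrier_mat m n" unfolding K_def using B by (auto intro!: mult_carrier_mat[of _ _ n])
  have cl: "cl \<in> carrier_mat n n"
    unfolding cl_def closed_loop_def using B by (auto intro!: minus_carrier_mat mult_carrier_mat[of _ n n ?P n] mult_carrier_mat[of B n m])
  then have ccl: "cmat cl \<in> carrier_mat n n" by simp
  \<comment> \<open>The identity in the factor \<open>M\<close> cancels in the error, which leaves
    \<open>H\<close> applied to the difference of the two states.\<close>
  define H where "H = (- cmat K) @\<^sub>r cmat C"
  have H: "H \<in> carrier_mat (m + m) n" unfolding H_def using K C by auto
  have Hv: "H *\<^sub>v d = (- (cmat K *\<^sub>v d)) @\<^sub>v (cmat C *\<^sub>v d)" if "d \<in> carrier_vec n" for d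
  proof -
    have "(- cmat K) *\<^sub>v d = - (cmat K *\<^sub>v d)"
      using K that by (intro eq_vecI) (auto simp: scalar_prod_def sum_negf)
    then show ?thesis
      unfolding H_def using mat_mult_append[of "- cmat K" m n "cmat C" m d] K C that by simp
  qed
  \<comment> \<open>The diagonal of \<open>Q + \<Sigma>\<close>, because \<open>Q\<close> has
    diagonal entries \<open>1 / \<sigma> i\<close>.\<close>
  define S where "S i = 1 / \<sigma> i + \<sigma> i" for i
  have S: "0 < S i" if "i < n" for i using \<sigma>[OF that] unfolding S_def by (simp add: add_pos_pos)
  have QP: "Q + ?P = mat_diag n S"
    unfolding Qdiag S_def mat_diag_def by (intro eq_matI) auto
  \<comment> \<open>The feedback contributes \<open>- 2 * rip \<beta> \<beta>\<close>, which turns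
    the indefinite right side of the control identity into minus the squared norm of
    \<open>H *\<^sub>v d\<close>.\<close>
  have L1: "2 * wip \<sigma> (cmat cl *\<^sub>v d) d + (vec_norm2 (H *\<^sub>v d))\<^sup>2 \<le> 0" if d: "d \<in> carrier_vec n" for d
  proof -
    define \<beta> s where "\<beta> = cmat K *\<^sub>v d" and "s = cmat ?P *\<^sub>v d"
    have carr: "\<beta> \<in> carrier_vec m" "cmat C *\<^sub>v d \<in> carrier_vec m" "cmat A *\<^sub>v d \<in> carrier_vec n"
      "cmat B *\<^sub>v \<beta> \<in> carrier_vec n" "cmat cl *\<^sub>v d \<in> carrier_vec n" "s \<in> carrier_vec n"
      unfolding \<beta>_def s_def using K C A B cl d P(1)
        mult_mat_vec_carrier[of "cmat ?P" n n d] by simp_all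
    have "(vec_norm2 (H *\<^sub>v d))\<^sup>2 = rip \<beta> \<beta> + rip (cmat C *\<^sub>v d) (cmat C *\<^sub>v d)"
    proof -
      have "rip (- \<beta>) (- \<beta>) = rip \<beta> \<beta>" by (simp add: wip_def)
      then show ?thesis unfolding vec_norm2_power2 Hv[OF d] \<beta>_def[symmetric] by (simp add: rip_append)
    qed
    moreover have "wip \<sigma> (cmat cl *\<^sub>v d) d = rip (cmat cl *\<^sub>v d) s"
      unfolding s_def using rip_diag[OF carr(5) d] by simp
    moreover have "cmat cl *\<^sub>v d = cmat A *\<^sub>v d - cmat B *\<^sub>v \<beta>"
      unfolding cl_def \<beta>_def K_def by (rule closed_loop_mult_vec[OF A B P(1) d])
    moreover have "rip (cmat B *\<^sub>v \<beta>) s = rip \<beta> \<beta>"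
    proof -
      have "cmat B\<^sup>T *\<^sub>v s = \<beta>"
        unfolding s_def \<beta>_def K_def using cmat_mult_vec[of "B\<^sup>T" m n ?P n d] B d by simp
      then show ?thesis using rip_adjoint[OF B carr(1,6)] by simp
    qed
    moreover have "2 * rip (cmat A *\<^sub>v d) s = rip \<beta> \<beta> - rip (cmat C *\<^sub>v d) (cmat C *\<^sub>v d)"
      unfolding s_def \<beta>_def K_def by (rule control_riccati_rip[OF A B C P ric d])
    ultimately show ?thesis using wip_diff_left[OF carr(3,4,6), of "\<lambda>_. 1"] by simp
  qed
  then have L1': "wip \<sigma> (cmat cl *\<^sub>v d) d \<le> 0" if "d \<in> carrier_vec n" for d
    using that by (smt (verit) zero_le_power2)
  have Qsym: "Q\<^sup>T = Q" using Q(2) unfolding sym_pos_def_def by auto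
  have L2: "2 * wip S (cmat cl *\<^sub>v p + 2 \<cdot>\<^sub>v (cmat B *\<^sub>v u)) p \<le> 4 * (vec_norm2 u)\<^sup>2"
    if p: "p \<in> carrier_vec n" and u: "u \<in> carrier_vec m" for p u :: "complex vec"
  proof -
    have "cmat cl *\<^sub>v p + 2 \<cdot>\<^sub>v (cmat B *\<^sub>v u) \<in> carrier_vec n" using ccl B p u by auto
    from rip_diag[OF this p, of S] show ?thesis
      using filter_dissipation[OF J R Q(1) Qsym B assms(8,9) P ric p u]
      unfolding QP vec_norm2_power2 cl_def by simp
  qed
  \<comment> \<open>For diagonal \<open>Q\<close> the effort-constraint model is plain
    truncation.\<close>
  have red: "ec_A r J R Q = lead_block r r A" "ec_B r B = lead_block r m B" "ec_C r Q B = lead_block m r C"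
  proof -
    have ecQ: "ec_Q r Q = mat_diag r (\<lambda>i. 1 / \<sigma> i)" unfolding Qdiag by (rule ec_Q_mat_diag[OF rn])
    have "lead_block r r J - lead_block r r R = lead_block r r (J - R)"
      using J R rn by (intro eq_matI) auto
    then show "ec_A r J R Q = lead_block r r A"
      unfolding ec_A_def ecQ assms(8) using lead_block_mult_mat_diag[OF JR rn rn] Qdiag by simp
    show ecB: "ec_B r B = lead_block r m B" unfolding ec_B_def using B by simp
    have "(lead_block r m B)\<^sup>T = lead_block m r B\<^sup>T" using B rn by (intro eq_matI) auto
    then show "ec_C r Q B = lead_block m r C"
      unfolding ec_C_def ecQ ecB assms(9) using lead_block_mult_mat_diag[of "B\<^sup>T" m n m r] B rn Qdiag by simp
  qed
  let ?c = "2 * (\<Sum>i = r..<n. \<sigma> i / sqrt (1 + (\<sigma> i)\<^sup>2))"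
  have c: "?c = 2 * (\<Sum>i = r..<n. sqrt (\<sigma> i / S i))"
  proof -
    have "\<sigma> i / sqrt (1 + (\<sigma> i)\<^sup>2) = sqrt (\<sigma> i / S i)" if "i < n" for i
    proof -
      have "\<sigma> i / S i = (\<sigma> i)\<^sup>2 / (1 + (\<sigma> i)\<^sup>2)"
        using \<sigma>[OF that] unfolding S_def by (simp add: field_simps power2_eq_square)
      then show ?thesis using \<sigma>[OF that] by (simp add: real_sqrt_divide)
    qed
    then show ?thesis by simp
  qed
  have c_nonneg: "0 \<le> ?c" using \<sigma> by (auto intro!: mult_nonneg_nonneg sum_nonneg divide_nonneg_nonneg less_imp_le[OF \<sigma>])
  have "spectral_norm (rcf A B C Pc z - rcf (ec_A r J R Q) (ec_B r B) (ec_C r Q B) (mat_diag r \<sigma>) z) \<le> ?c"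
    if z: "0 < Re z" for z
  proof (rule spectral_norm_le[OF _ c_nonneg])
    \<comment> \<open>At order \<open>n\<close> the leading blocks are the whole matrices, so the
      full model is described in the same form as the reduced one.\<close>
    note full = rcf_lead_block[OF A B C order.refl _ z \<sigma> L1'[unfolded cl_def],
        unfolded lead_block_self[OF A] lead_block_self[OF B] lead_block_self[OF C], folded cl_def K_def]
    note reduced = rcf_lead_block[OF A B C rn _ z \<sigma> L1'[unfolded cl_def], folded cl_def K_def red]
    let ?F = "rcf A B C ?P z" and ?G = "rcf (ec_A r J R Q) (ec_B r B) (ec_C r Q B) (mat_diag r \<sigma>) z"
    have FG: "?F \<in> carrier_mat (m + m) m" "?G \<in> carrier_mat (m + m) m"
      using full(2)[OF zero_carrier_vec] reduced(2)[OF zero_carrier_vec] by auto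
    fix u :: "complex vec" assume "u \<in> carrier_vec (dim_col (rcf A B C Pc z - ?G))"
    then have u: "u \<in> carrier_vec m" using FG assms(14) by simp
    obtain x where x: "trunc_response (cmat cl) (cmat B *\<^sub>v u) z n x"
      and Fu: "?F *\<^sub>v u = (u - cmat K *\<^sub>v x) @\<^sub>v (cmat C *\<^sub>v x)" using full(1)[OF u] by auto
    obtain y where y: "trunc_response (cmat cl) (cmat B *\<^sub>v u) z r y"
      and Gu: "?G *\<^sub>v u = (u - cmat K *\<^sub>v y) @\<^sub>v (cmat C *\<^sub>v y)" using reduced(1)[OF u] by auto
    have xy: "x \<in> carrier_vec n" "y \<in> carrier_vec n"
      using x y ccl unfolding trunc_response_def by auto
    have "(rcf A B C Pc z - ?G) *\<^sub>v u = ?F *\<^sub>v u - ?G *\<^sub>v u"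
      unfolding assms(14) by (rule minus_mult_distrib_mat_vec[OF FG u])
    also have "\<dots> = H *\<^sub>v (x - y)"
    proof -
      have "cmat K *\<^sub>v (x - y) = cmat K *\<^sub>v x - cmat K *\<^sub>v y" "cmat C *\<^sub>v (x - y) = cmat C *\<^sub>v x - cmat C *\<^sub>v y"
        using K C xy by (auto simp: mult_minus_distrib_mat_vec[of _ m n])
      then show ?thesis
        unfolding Fu Gu using Hv[of "x - y"] xy u K C
        by (intro eq_vecI) (auto simp del: index_mult_mat_vec)
    qed
    also have "vec_norm2 (H *\<^sub>v (x - y)) \<le> 2 * (\<Sum>i=r..<n. sqrt (\<sigma> i / S i)) * vec_norm2 u"
    proof (rule balanced_truncation_bound[OF ccl _ H z \<sigma> S L1 _ _ y rn order.refl x])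
      show "cmat B *\<^sub>v u \<in> carrier_vec n" using B u by auto
    qed (use L2 u in auto)
    finally show "vec_norm2 ((rcf A B C Pc z - ?G) *\<^sub>v u) \<le> ?c * vec_norm2 u"
      unfolding c .
  qed
  then show ?thesis
    unfolding hinf_norm_def by (intro SUP_least) simp
qed

end
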